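(* Under the equivalence between $r$-split restriction categories (with restriction functors) and $\mathsf M$-categories (with $\mathsf M$-category functors), $r$-split latent fibrations correspond precisely to $\mathsf M$-fibrations. That is: (i) if $\mathsf p:\mathbb E\to\mathbb B$ is an $r$-split latent fibration, then the induced $\mathsf M$-category functor $\mathsf{Total}(\mathsf p):(\mathsf{Total}(\mathbb E),\mathsf{Monic}(\mathbb E))\to(\mathsf{Total}(\mathbb B),\mathsf{Monic}(\mathbb B))$ is an $\mathsf M$-fibration; (ii) if $\mathsf q:(\mathbb T,\mathsf M_{\mathbb T})\to(\mathbb S,\mathsf M_{\mathbb S})$ is an $\mathsf M$-fibration, then $\mathsf{Par}(\mathsf q):\mathsf{Par}(\mathbb T,\mathsf M_{\mathbb T})\to\mathsf{Par}(\mathbb S,\mathsf M_{\mathbb S})$ is an $r$-split latent fibration.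
   Context: Composition is written in diagrammatic order. A restriction category is a category with an operation sending each $f:A\to B$ to $\overline f:A\to A$ such that (R.1) $\overline f f=f$; (R.2) $\overline f\,\overline g=\overline g\,\overline f$ for $f,g$ with the same domain; (R.3) $\overline{\overline f g}=\overline f\,\overline g$ for $f,g$ with the same domain; (R.4) $f\overline g=\overline{fg}\,f$ for composable $f,g$. A restriction idempotent is an endomap $e=\overline e$; it splits if $e=rm$ with $mr=1$. A map $f$ is total if $\overline f=1$; total maps form a subcategory $\mathsf{Total}(\mathbb X)$. A restriction monic is a map $m$ for which there is $r$ with $mr=1$ and $rm=\overline r$; the class of these is $\mathsf{Monic}(\mathbb X)$. A restriction functor is a functor preserving restriction. A restriction category is $r$-split if all its restriction idempotents split. A commuting triangle $kf=g$ (with left factor $k$) is precise if $\overline g=\overline k$. For a restriction functor $\mathsf p:\mathbb E\to\mathbb B$, an arrow $f':X'\to X$ of $\mathbb E$ is $\mathsf p$-prone if whenever $g:Y\to X$ in $\mathbb E$ and $h:\mathsf p(Y)\to\mathsf p(X')$ in $\mathbb B$ are such that $h\,\mathsf p(f')=\mathsf p(g)$ is precise, there is a unique $\widetilde h:Y\to X'$ with $\mathsf p(\widetilde h)=h$ and $\widetilde h f'=g$ precise. $\mathsf p$ is a latent fibration if for each $X\in\mathbb E$ and $f:A\to\mathsf p(X)$ in $\mathbb B$ there is a $\mathsf p$-prone $f':X'\to X$ with $\mathsf p(f')=f$. The restriction functor $\mathsf p$ is well-fibred if for all $B\in\mathbb B$, whenever a restriction idempotent in the fibre $\mathsf p^{-1}(B)$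 (objects sent to $B$, maps sent to $1_B$) splits in $\mathbb E$, it also splits in $\mathsf p^{-1}(B)$. It is $r$-split if $\mathbb E$ and $\mathbb B$ are $r$-split and $\mathsf p$ is well-fibred. An $\mathsf M$-category $(\mathbb X,\mathsf M)$ is a category with a class $\mathsf M$ of monics containing the isomorphisms, closed under composition, and such that pullbacks of $\mathsf M$-maps along arbitrary maps exist and are in $\mathsf M$. An $\mathsf M$-category functor preserves $\mathsf M$-maps and pullbacks along $\mathsf M$-maps. $\mathsf{Par}(\mathbb X,\mathsf M)$ is the restriction category with the objects of $\mathbb X$, whose maps $X\to Y$ are isomorphism classes of spans $X\xleftarrow{m}X'\xrightarrow{f}Y$ with $m\in\mathsf M$, composed by pullback, with $\overline{(m,f)}=(m,m)$; $\mathsf{Par}(\mathsf q)$ applies $\mathsf q$ to both legs. The equivalence is given by $(\mathbb X,\mathsf M)\mapsto\mathsf{Par}(\mathbb X,\mathsf M)$ and $\mathbb E\mapsto(\mathsf{Total}(\mathbb E),\mathsf{Monic}(\mathbb E))$. An $\mathsf M$-category functor $\mathsf q:(\mathbb T,\mathsf M_{\mathbb T})\to(\mathbb S,\mathsf M_{\mathbb S})$ is $\mathsf M$-plentiful if for every object $X\in\mathbb T$ and every $m:\mathsf q(X)\to Y$ in $\mathsf M_{\mathbb S}$ there is $n:X\to X'$ in $\mathsf M_{\mathbb T}$ with $\mathsf q(n)=m$. It is an $\mathsf M$-fibration if it is an ordinary (Grothendieck) fibration and is $\mathsf M$-plentiful. *)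

theory Defs
  imports Main
begin

section \<open>Categories and functors\<close>

text \<open>Categories are given by carrier sets of objects and arrows. Composition is in diagrammatic
  order: \<open>f \<cdot>\<^bsub>C\<^esub> g\<close> is first \<open>f\<close>, then \<open>g\<close>; it is unspecified on non-composable pairs, and all
  operations are unspecified outside the carriers.\<close>

record ('o, 'a) cat =
  Obj :: "'o set"
  Arr :: "'a set"
  Dom :: "'a \<Rightarrow> 'o"
  Cod :: "'a \<Rightarrow> 'o"
  Ident :: "'o \<Rightarrow> 'a"
  Comp :: "'a \<Rightarrow> 'a \<Rightarrow> 'a"  (infixl "\<cdot>\<index>" 70)

definition hom :: "('o, 'a, 'z) cat_scheme \<Rightarrow> 'o \<Rightarrow> 'o \<Rightarrow> 'a set" where
  "hom C X Y = {f \<in> Arr C. Dom C f = X \<and> Cod C f = Y}"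

locale category =
  fixes C :: "('o, 'a, 'z) cat_scheme" (structure)
  assumes Dom_in_Obj: "f \<in> Arr C \<Longrightarrow> Dom C f \<in> Obj C"
    and Cod_in_Obj: "f \<in> Arr C \<Longrightarrow> Cod C f \<in> Obj C"
    and Ident_in_hom: "X \<in> Obj C \<Longrightarrow> Ident C X \<in> hom C X X"
    and Comp_in_hom: "\<lbrakk>f \<in> hom C X Y; g \<in> hom C Y Z\<rbrakk> \<Longrightarrow> f \<cdot> g \<in> hom C X Z"
    and Ident_left: "f \<in> Arr C \<Longrightarrow> Ident C (Dom C f) \<cdot> f = f"
    and Ident_right: "f \<in> Arr C \<Longrightarrow> f \<cdot> Ident C (Cod C f) = f"
    and Comp_assoc:
      "\<lbrakk>f \<in> hom C W X; g \<in> hom C X Y; h \<in> hom C Y Z\<rbrakk> \<Longrightarrow> (f \<cdot> g) \<cdot> h = f \<cdot> (g \<cdot> h)"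

definition monic :: "('o, 'a, 'z) cat_scheme \<Rightarrow> 'a \<Rightarrow> bool" where
  "monic C m \<longleftrightarrow> m \<in> Arr C \<and>
     (\<forall>W. \<forall>f \<in> hom C W (Dom C m). \<forall>g \<in> hom C W (Dom C m). f \<cdot>\<^bsub>C\<^esub> m = g \<cdot>\<^bsub>C\<^esub> m \<longrightarrow> f = g)"

definition is_iso :: "('o, 'a, 'z) cat_scheme \<Rightarrow> 'a \<Rightarrow> bool" where
  "is_iso C f \<longleftrightarrow> f \<in> Arr C \<and>
     (\<exists>g \<in> hom C (Cod C f) (Dom C f).
        f \<cdot>\<^bsub>C\<^esub> g = Ident C (Dom C f) \<and> g \<cdot>\<^bsub>C\<^esub> f = Ident C (Cod C f))"

text \<open>\<open>is_pullback C u v f g\<close>: the square with \<open>u \<cdot> f = v \<cdot> g\<close> is a pullback, where \<open>u\<close> is the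
  projection opposite \<open>g\<close> (the pullback of \<open>g\<close> along \<open>f\<close>) and \<open>v\<close> the one opposite \<open>f\<close>.\<close>

definition is_pullback :: "('o, 'a, 'z) cat_scheme \<Rightarrow> 'a \<Rightarrow> 'a \<Rightarrow> 'a \<Rightarrow> 'a \<Rightarrow> bool" where
  "is_pullback C u v f g \<longleftrightarrow>
     f \<in> Arr C \<and> g \<in> Arr C \<and> Cod C f = Cod C g \<and>
     u \<in> hom C (Dom C u) (Dom C f) \<and> v \<in> hom C (Dom C u) (Dom C g) \<and>
     u \<cdot>\<^bsub>C\<^esub> f = v \<cdot>\<^bsub>C\<^esub> g \<and>
     (\<forall>W. \<forall>x \<in> hom C W (Dom C f). \<forall>y \<in> hom C W (Dom C g). x \<cdot>\<^bsub>C\<^esub> f = y \<cdot>\<^bsub>C\<^esub> g \<longrightarrow>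
        (\<exists>!t. t \<in> hom C W (Dom C u) \<and> t \<cdot>\<^bsub>C\<^esub> u = x \<and> t \<cdot>\<^bsub>C\<^esub> v = y))"

definition splits :: "('o, 'a, 'z) cat_scheme \<Rightarrow> 'a \<Rightarrow> bool" where
  "splits C e \<longleftrightarrow>
     (\<exists>X \<in> Obj C. \<exists>Y \<in> Obj C. \<exists>r \<in> hom C X Y. \<exists>m \<in> hom C Y X.
        e = r \<cdot>\<^bsub>C\<^esub> m \<and> m \<cdot>\<^bsub>C\<^esub> r = Ident C Y)"

record ('o1, 'a1, 'o2, 'a2) func =
  OMap :: "'o1 \<Rightarrow> 'o2"
  AMap :: "'a1 \<Rightarrow> 'a2"

locale cat_functor = source: category C + target: category D
  for C :: "('o1, 'a1, 'z1) cat_scheme" and D :: "('o2, 'a2, 'z2) cat_scheme"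
    and F :: "('o1, 'a1, 'o2, 'a2) func" +
  assumes OMap_in_Obj: "X \<in> Obj C \<Longrightarrow> OMap F X \<in> Obj D"
    and AMap_in_hom: "f \<in> hom C X Y \<Longrightarrow> AMap F f \<in> hom D (OMap F X) (OMap F Y)"
    and AMap_Ident: "X \<in> Obj C \<Longrightarrow> AMap F (Ident C X) = Ident D (OMap F X)"
    and AMap_Comp:
      "\<lbrakk>f \<in> hom C X Y; g \<in> hom C Y Z\<rbrakk> \<Longrightarrow> AMap F (f \<cdot>\<^bsub>C\<^esub> g) = AMap F f \<cdot>\<^bsub>D\<^esub> AMap F g"


section \<open>Restriction categories\<close>

record ('o, 'a) rcat = "('o, 'a) cat" +
  Rst :: "'a \<Rightarrow> 'a"

locale restriction_category = category C
  for C :: "('o, 'a, 'z) rcat_scheme" (structure) +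
  assumes Rst_in_hom: "f \<in> hom C X Y \<Longrightarrow> Rst C f \<in> hom C X X"
    and R1: "f \<in> Arr C \<Longrightarrow> Rst C f \<cdot> f = f"
    and R2: "\<lbrakk>f \<in> hom C X Y; g \<in> hom C X Z\<rbrakk> \<Longrightarrow> Rst C f \<cdot> Rst C g = Rst C g \<cdot> Rst C f"
    and R3: "\<lbrakk>f \<in> hom C X Y; g \<in> hom C X Z\<rbrakk> \<Longrightarrow> Rst C (Rst C f \<cdot> g) = Rst C f \<cdot> Rst C g"
    and R4: "\<lbrakk>f \<in> hom C X Y; g \<in> hom C Y Z\<rbrakk> \<Longrightarrow> f \<cdot> Rst C g = Rst C (f \<cdot> g) \<cdot> f"

definition restriction_idempotent :: "('o, 'a, 'z) rcat_scheme \<Rightarrow> 'a \<Rightarrow> bool" where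
  "restriction_idempotent C e \<longleftrightarrow> e \<in> hom C (Dom C e) (Dom C e) \<and> e = Rst C e"

definition total_map :: "('o, 'a, 'z) rcat_scheme \<Rightarrow> 'a \<Rightarrow> bool" where
  "total_map C f \<longleftrightarrow> f \<in> Arr C \<and> Rst C f = Ident C (Dom C f)"

definition restriction_monic :: "('o, 'a, 'z) rcat_scheme \<Rightarrow> 'a \<Rightarrow> bool" where
  "restriction_monic C m \<longleftrightarrow> m \<in> Arr C \<and>
     (\<exists>r \<in> hom C (Cod C m) (Dom C m). m \<cdot>\<^bsub>C\<^esub> r = Ident C (Dom C m) \<and> r \<cdot>\<^bsub>C\<^esub> m = Rst C r)"

locale r_split_category = restriction_category +
  assumes restriction_idempotents_split: "restriction_idempotent C e \<Longrightarrow> splits C e"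

locale restriction_functor =
  source: restriction_category E + target: restriction_category B + cat_functor E B p
  for E :: "('o1, 'a1, 'z1) rcat_scheme" and B :: "('o2, 'a2, 'z2) rcat_scheme"
    and p :: "('o1, 'a1, 'o2, 'a2) func" +
  assumes AMap_Rst: "f \<in> Arr E \<Longrightarrow> AMap p (Rst E f) = Rst B (AMap p f)"

text \<open>\<open>precise_triangle C k f g\<close>: the triangle \<open>k \<cdot> f = g\<close>, with left factor \<open>k\<close>, commutes and is
  precise.\<close>

definition precise_triangle :: "('o, 'a, 'z) rcat_scheme \<Rightarrow> 'a \<Rightarrow> 'a \<Rightarrow> 'a \<Rightarrow> bool" where
  "precise_triangle C k f g \<longleftrightarrow>
     k \<in> Arr C \<and> f \<in> hom C (Cod C k) (Cod C f) \<and> k \<cdot>\<^bsub>C\<^esub> f = g \<and> Rst C g = Rst C k"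

definition prone ::
  "('o1, 'a1, 'z1) rcat_scheme \<Rightarrow> ('o2, 'a2, 'z2) rcat_scheme \<Rightarrow> ('o1, 'a1, 'o2, 'a2) func \<Rightarrow> 'a1 \<Rightarrow> bool"
where
  "prone E B p f' \<longleftrightarrow> f' \<in> Arr E \<and>
     (\<forall>Y. \<forall>g \<in> hom E Y (Cod E f'). \<forall>h \<in> hom B (OMap p Y) (OMap p (Dom E f')).
        precise_triangle B h (AMap p f') (AMap p g) \<longrightarrow>
        (\<exists>!k. k \<in> hom E Y (Dom E f') \<and> AMap p k = h \<and> precise_triangle E k f' g))"

locale latent_fibration = restriction_functor +
  assumes prone_lift:
    "\<lbrakk>X \<in> Obj E; f \<in> hom B A (OMap p X)\<rbrakk> \<Longrightarrow>
       \<exists>f' \<in> Arr E. Cod E f' = X \<and> prone E B p f' \<and> AMap p f' = f"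

definition fibre ::
  "('o1, 'a1, 'z1) rcat_scheme \<Rightarrow> ('o2, 'a2, 'z2) rcat_scheme \<Rightarrow> ('o1, 'a1, 'o2, 'a2) func \<Rightarrow> 'o2
     \<Rightarrow> ('o1, 'a1) rcat"
where
  "fibre E B p A =
     \<lparr>Obj = {X \<in> Obj E. OMap p X = A},
      Arr = {f \<in> Arr E. OMap p (Dom E f) = A \<and> OMap p (Cod E f) = A \<and> AMap p f = Ident B A},
      Dom = Dom E, Cod = Cod E, Ident = Ident E, Comp = Comp E, Rst = Rst E\<rparr>"

definition well_fibred ::
  "('o1, 'a1, 'z1) rcat_scheme \<Rightarrow> ('o2, 'a2, 'z2) rcat_scheme \<Rightarrow> ('o1, 'a1, 'o2, 'a2) func \<Rightarrow> bool"
where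
  "well_fibred E B p \<longleftrightarrow>
     (\<forall>A \<in> Obj B. \<forall>e. restriction_idempotent (fibre E B p A) e \<and> splits E e
        \<longrightarrow> splits (fibre E B p A) e)"

locale r_split_functor =
  restriction_functor + source: r_split_category E + target: r_split_category B +
  assumes well_fibred: "well_fibred E B p"

locale r_split_latent_fibration = r_split_functor + latent_fibration


section \<open>M-categories\<close>

record ('o, 'a) mcat = "('o, 'a) cat" +
  Mon :: "'a set"

locale m_category = category C
  for C :: "('o, 'a, 'z) mcat_scheme" (structure) +
  assumes Mon_monic: "m \<in> Mon C \<Longrightarrow> monic C m"
    and iso_in_Mon: "is_iso C f \<Longrightarrow> f \<in> Mon C"
    and Comp_in_Mon: "\<lbrakk>m \<in> Mon C; n \<in> Mon C; Cod C m = Dom C n\<rbrakk> \<Longrightarrow> m \<cdot> n \<in> Mon C"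
    and Mon_pullback_exists:
      "\<lbrakk>m \<in> Mon C; f \<in> Arr C; Cod C f = Cod C m\<rbrakk> \<Longrightarrow> \<exists>u v. is_pullback C u v f m"
    and Mon_pullback_stable: "\<lbrakk>m \<in> Mon C; is_pullback C u v f m\<rbrakk> \<Longrightarrow> u \<in> Mon C"

locale m_functor =
  source: m_category T + target: m_category S + cat_functor T S q
  for T :: "('o1, 'a1, 'z1) mcat_scheme" and S :: "('o2, 'a2, 'z2) mcat_scheme"
    and q :: "('o1, 'a1, 'o2, 'a2) func" +
  assumes AMap_in_Mon: "m \<in> Mon T \<Longrightarrow> AMap q m \<in> Mon S"
    and AMap_pullback:
      "\<lbrakk>m \<in> Mon T; is_pullback T u v f m\<rbrakk> \<Longrightarrow>
         is_pullback S (AMap q u) (AMap q v) (AMap q f) (AMap q m)"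

definition cartesian ::
  "('o1, 'a1, 'z1) cat_scheme \<Rightarrow> ('o2, 'a2, 'z2) cat_scheme \<Rightarrow> ('o1, 'a1, 'o2, 'a2) func \<Rightarrow> 'a1 \<Rightarrow> bool"
where
  "cartesian T S q f' \<longleftrightarrow> f' \<in> Arr T \<and>
     (\<forall>Y. \<forall>g \<in> hom T Y (Cod T f'). \<forall>h \<in> hom S (OMap q Y) (OMap q (Dom T f')).
        h \<cdot>\<^bsub>S\<^esub> AMap q f' = AMap q g \<longrightarrow>
        (\<exists>!k. k \<in> hom T Y (Dom T f') \<and> AMap q k = h \<and> k \<cdot>\<^bsub>T\<^esub> f' = g))"

locale fibration = cat_functor +
  assumes cartesian_lift:
    "\<lbrakk>X \<in> Obj C; f \<in> hom D A (OMap F X)\<rbrakk> \<Longrightarrow>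
       \<exists>f' \<in> Arr C. Cod C f' = X \<and> cartesian C D F f' \<and> AMap F f' = f"

definition m_plentiful ::
  "('o1, 'a1, 'z1) mcat_scheme \<Rightarrow> ('o2, 'a2, 'z2) mcat_scheme \<Rightarrow> ('o1, 'a1, 'o2, 'a2) func \<Rightarrow> bool"
where
  "m_plentiful T S q \<longleftrightarrow>
     (\<forall>X \<in> Obj T. \<forall>m \<in> Mon S. Dom S m = OMap q X \<longrightarrow>
        (\<exists>n \<in> Mon T. Dom T n = X \<and> AMap q n = m))"

locale m_fibration = m_functor T S q + fibration T S q
  for T :: "('o1, 'a1, 'z1) mcat_scheme" and S :: "('o2, 'a2, 'z2) mcat_scheme"
    and q :: "('o1, 'a1, 'o2, 'a2) func" +
  assumes m_plentiful: "m_plentiful T S q"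


section \<open>Passing between restriction categories and M-categories\<close>

text \<open>The M-category of total maps and restriction monics. A functor is only looked at on the
  carriers, so a restriction functor \<open>p\<close> itself, read as a functor between the subcategories of total
  maps, is the induced functor \<open>Total(p)\<close>.\<close>

definition Total_mcat :: "('o, 'a, 'z) rcat_scheme \<Rightarrow> ('o, 'a) mcat" where
  "Total_mcat E =
     \<lparr>Obj = Obj E, Arr = {f \<in> Arr E. total_map E f},
      Dom = Dom E, Cod = Cod E, Ident = Ident E, Comp = Comp E,
      Mon = {m \<in> Arr E. restriction_monic E m}\<rparr>"

text \<open>A pair \<open>(m, f)\<close> in \<open>spans C X Y\<close> is a span with left leg \<open>m\<close> into \<open>X\<close> and right leg \<open>f\<close> into
  \<open>Y\<close>.\<close>

definition spans :: "('o, 'a, 'z) mcat_scheme \<Rightarrow> 'o \<Rightarrow> 'o \<Rightarrow> ('a \<times> 'a) set" where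
  "spans C X Y =
     {(m, f). m \<in> Mon C \<and> f \<in> Arr C \<and> Dom C m = Dom C f \<and> Cod C m = X \<and> Cod C f = Y}"

definition span_iso :: "('o, 'a, 'z) mcat_scheme \<Rightarrow> 'a \<times> 'a \<Rightarrow> 'a \<times> 'a \<Rightarrow> bool" where
  "span_iso C s t \<longleftrightarrow>
     (\<exists>i \<in> hom C (Dom C (fst s)) (Dom C (fst t)).
        is_iso C i \<and> i \<cdot>\<^bsub>C\<^esub> fst t = fst s \<and> i \<cdot>\<^bsub>C\<^esub> snd t = snd s)"

definition span_class :: "('o, 'a, 'z) mcat_scheme \<Rightarrow> 'o \<Rightarrow> 'o \<Rightarrow> 'a \<times> 'a \<Rightarrow> ('a \<times> 'a) set" where
  "span_class C X Y s = {t \<in> spans C X Y. span_iso C s t}"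

text \<open>An arrow of \<open>Par C\<close> is a triple of source, isomorphism class of spans, and target. Operations on
  classes are given as the union, over all representatives (and, for composition, over all choices
  of the pullback), of the class of the resulting span; all these classes coincide.\<close>

type_synonym ('o, 'a) par_arr = "'o \<times> ('a \<times> 'a) set \<times> 'o"

definition Par_Comp ::
  "('o, 'a, 'z) mcat_scheme \<Rightarrow> ('o, 'a) par_arr \<Rightarrow> ('o, 'a) par_arr \<Rightarrow> ('o, 'a) par_arr"
where
  "Par_Comp C = (\<lambda>(X, \<Phi>, Y) (Y', \<Psi>, Z).
     (X, \<Union>{span_class C X Z (u \<cdot>\<^bsub>C\<^esub> m, v \<cdot>\<^bsub>C\<^esub> g) | m f n g u v.
            (m, f) \<in> \<Phi> \<and> (n, g) \<in> \<Psi> \<and> is_pullback C u v f n}, Z))"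

definition Par :: "('o, 'a, 'z) mcat_scheme \<Rightarrow> ('o, ('o, 'a) par_arr) rcat" where
  "Par C =
     \<lparr>Obj = Obj C,
      Arr = {(X, span_class C X Y s, Y) | X Y s. X \<in> Obj C \<and> Y \<in> Obj C \<and> s \<in> spans C X Y},
      Dom = (\<lambda>(X, \<Phi>, Y). X),
      Cod = (\<lambda>(X, \<Phi>, Y). Y),
      Ident = (\<lambda>X. (X, span_class C X X (Ident C X, Ident C X), X)),
      Comp = Par_Comp C,
      Rst = (\<lambda>(X, \<Phi>, Y). (X, \<Union>(m, f) \<in> \<Phi>. span_class C X X (m, m), X))\<rparr>"

definition Par_map ::
  "('o2, 'a2, 'z2) mcat_scheme \<Rightarrow> ('o1, 'a1, 'o2, 'a2) func
     \<Rightarrow> ('o1, ('o1, 'a1) par_arr, 'o2, ('o2, 'a2) par_arr) func"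
where
  "Par_map S q =
     \<lparr>OMap = OMap q,
      AMap = (\<lambda>(X, \<Phi>, Y).
        (OMap q X,
         \<Union>(m, f) \<in> \<Phi>. span_class S (OMap q X) (OMap q Y) (AMap q m, AMap q f),
         OMap q Y))\<rparr>"

end

(* (i) For a restriction monic m with retraction r, a splitting s n of the restriction of f r gives the
   pullback n of m along f in the category of total maps; restriction functors preserve splittings, hence
   these pullbacks. A prone lift of a total map, restricted to its domain of definition (which can be split
   in the fibre), is cartesian. Plentifulness comes from a prone lift r' of a retraction r of m: the
   identity factors through r' by some n over m, and r' n is the restriction of r' by uniqueness of
   factorizations.

   (ii) A partial map given by a span (m, g) with target over X is lifted in two steps: g to a cartesian
   arrow g', then m to some n in M starting at the domain of g'. The span (n, g') is prone, because a
   precise triangle forces the left factor to have the same domain of definition as the composite, and so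
   reduces the lifting problem to one for the total map g'. *)

theory Submission
  imports Defs
begin

text \<open>What makes the pullbacks in (i) tractable is that their description by splittings
  consists of equations in composition and restriction, with no quantification over arrows. It
  therefore survives any restriction functor, and every other pullback of the same cospan differs
  from the split one by an isomorphism. Well-fibredness of \<open>Par_map S q\<close> in (ii) is not
  a lifting property and needs its own argument. An idempotent in a fibre comes from an M-map m such
  that the span (q m, q m) represents an identity. This makes q m an isomorphism, but not an
  identity, so the evident splitting through the domain of m may leave the fibre. The fibration
  property repairs this: a cartesian lift of the inverse of q m is an isomorphism, and composing it
  with m leaves the idempotent unchanged while moving its splitting object into the fibre. Worked
  out on spans, the laws of \<open>Par\<close> would call for pasting of pullbacks and for choices
  of representatives. Relations avoid both: restriction becomes the identity relation on the domain,
  and the union over representatives collapses to one class.\<close>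

section \<open>Categories\<close>

context category
begin

lemma homD: "f \<in> hom C X Y \<Longrightarrow> f \<in> Arr C" "f \<in> hom C X Y \<Longrightarrow> Dom C f = X"
  "f \<in> hom C X Y \<Longrightarrow> Cod C f = Y"
  by (auto simp: hom_def)

lemma Comp_type [simp]:
  assumes "f \<in> Arr C" "g \<in> Arr C" "Cod C f = Dom C g"
  shows "f \<cdot> g \<in> Arr C" "Dom C (f \<cdot> g) = Dom C f" "Cod C (f \<cdot> g) = Cod C g"
  using Comp_in_hom[of f "Dom C f" "Cod C f" g "Cod C g"] assms by (auto simp: hom_def)

lemma Ident_type [simp]:
  assumes "X \<in> Obj C"
  shows "Ident C X \<in> Arr C" "Dom C (Ident C X) = X" "Cod C (Ident C X) = X"
  using Ident_in_hom[OF assms] by (auto simp: hom_def)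

lemma assoc:
  assumes "f \<in> Arr C" "g \<in> Arr C" "h \<in> Arr C" "Cod C f = Dom C g" "Cod C g = Dom C h"
  shows "(f \<cdot> g) \<cdot> h = f \<cdot> (g \<cdot> h)"
  using Comp_assoc[of f "Dom C f" "Cod C f" g "Cod C g" h "Cod C h"] assms by (auto simp: hom_def)

lemma Ident_left' [simp]: "f \<in> Arr C \<Longrightarrow> Dom C f = X \<Longrightarrow> Ident C X \<cdot> f = f"
  using Ident_left by auto

lemma Ident_right' [simp]: "f \<in> Arr C \<Longrightarrow> Cod C f = X \<Longrightarrow> f \<cdot> Ident C X = f"
  using Ident_right by auto

declare Dom_in_Obj [simp] Cod_in_Obj [simp]

lemma monicD:
  assumes "monic C m" "f \<cdot> m = g \<cdot> m" "f \<in> Arr C" "g \<in> Arr C"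
    "Dom C f = Dom C g" "Cod C f = Dom C m" "Cod C g = Dom C m"
  shows "f = g"
  using assms unfolding monic_def hom_def by auto

lemma split_mono_monic:
  assumes "m \<in> Arr C" "r \<in> Arr C" "Cod C m = Dom C r" "m \<cdot> r = Ident C (Dom C m)"
  shows "monic C m"
  unfolding monic_def
proof (intro conjI allI ballI impI)
  fix W f g
  assume f: "f \<in> hom C W (Dom C m)" and g: "g \<in> hom C W (Dom C m)" and e: "f \<cdot> m = g \<cdot> m"
  have "Cod C r = Dom C m"
    using assms by (metis Comp_type(3) Ident_type(3) Dom_in_Obj)
  then have "f = f \<cdot> (m \<cdot> r)" "g = g \<cdot> (m \<cdot> r)"
    using f g assms by (auto simp: hom_def)
  then show "f = g"
    using f g e assms by (metis assoc homD)
qed (use assms in auto)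

section \<open>Pullback squares\<close>

lemma is_pullbackD:
  assumes "is_pullback C u v f g"
  shows "f \<in> Arr C" "g \<in> Arr C" "u \<in> Arr C" "v \<in> Arr C" "Cod C f = Cod C g" "Dom C v = Dom C u"
    "Cod C u = Dom C f" "Cod C v = Dom C g" "u \<cdot> f = v \<cdot> g"
  using assms unfolding is_pullback_def hom_def by auto

lemma is_pullback_ex1:
  assumes "is_pullback C u v f g" "x \<in> hom C W (Dom C f)" "y \<in> hom C W (Dom C g)" "x \<cdot> f = y \<cdot> g"
  shows "\<exists>!t. t \<in> hom C W (Dom C u) \<and> t \<cdot> u = x \<and> t \<cdot> v = y"
proof -
  have "\<forall>W. \<forall>x \<in> hom C W (Dom C f). \<forall>y \<in> hom C W (Dom C g). x \<cdot> f = y \<cdot> g \<longrightarrow>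
        (\<exists>!t. t \<in> hom C W (Dom C u) \<and> t \<cdot> u = x \<and> t \<cdot> v = y)"
    using assms(1) unfolding is_pullback_def by (elim conjE)
  from this[rule_format, OF assms(2-4)] show ?thesis .
qed

lemma is_pullback_lift:
  assumes "is_pullback C u v f g" "x \<in> Arr C" "y \<in> Arr C" "Dom C x = Dom C y"
    "Cod C x = Dom C f" "Cod C y = Dom C g" "x \<cdot> f = y \<cdot> g"
  obtains t where "t \<in> Arr C" "Dom C t = Dom C x" "Cod C t = Dom C u" "t \<cdot> u = x" "t \<cdot> v = y"
proof -
  have "x \<in> hom C (Dom C x) (Dom C f)" "y \<in> hom C (Dom C x) (Dom C g)"
    using assms by (simp_all add: hom_def)
  from ex1_implies_ex[OF is_pullback_ex1[OF assms(1) this assms(7)]] show thesis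
    using that by (auto simp: hom_def)
qed

lemma is_pullback_eq:
  assumes "is_pullback C u v f g" "s \<in> Arr C" "t \<in> Arr C" "Dom C s = Dom C t"
    "Cod C s = Dom C u" "Cod C t = Dom C u" "s \<cdot> u = t \<cdot> u" "s \<cdot> v = t \<cdot> v"
  shows "s = t"
proof -
  note p = is_pullbackD[OF assms(1)]
  have "(t \<cdot> u) \<cdot> f = (t \<cdot> v) \<cdot> g" using assms(3,6) p by (simp add: assoc)
  moreover have "t \<cdot> u \<in> hom C (Dom C t) (Dom C f)" "t \<cdot> v \<in> hom C (Dom C t) (Dom C g)"
    using assms(3,6) p by (simp_all add: hom_def)
  ultimately have "\<exists>!w. w \<in> hom C (Dom C t) (Dom C u) \<and> w \<cdot> u = t \<cdot> u \<and> w \<cdot> v = t \<cdot> v"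
    using is_pullback_ex1[OF assms(1)] by blast
  moreover have "s \<in> hom C (Dom C t) (Dom C u)" "t \<in> hom C (Dom C t) (Dom C u)"
    using assms(2-6) by (auto simp: hom_def)
  ultimately show ?thesis using assms(7,8) by blast
qed

lemma is_pullback_unique:
  assumes "is_pullback C u v f g" "is_pullback C u' v' f g"
  obtains i where "is_iso C i" "i \<in> Arr C" "Dom C i = Dom C u" "Cod C i = Dom C u'" "u = i \<cdot> u'" "v = i \<cdot> v'"
proof -
  note p = is_pullbackD[OF assms(1)] and p' = is_pullbackD[OF assms(2)]
  obtain i where i: "i \<in> Arr C" "Dom C i = Dom C u" "Cod C i = Dom C u'" "i \<cdot> u' = u" "i \<cdot> v' = v"
    using is_pullback_lift[OF assms(2), of u v] p by auto
  obtain j where j: "j \<in> Arr C" "Dom C j = Dom C u'" "Cod C j = Dom C u" "j \<cdot> u = u'" "j \<cdot> v = v'"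
    using is_pullback_lift[OF assms(1), of u' v'] p' by auto
  have "i \<cdot> j = Ident C (Dom C u)"
    by (rule is_pullback_eq[OF assms(1)]) (use i j p p' in \<open>auto simp: assoc\<close>)
  moreover have "j \<cdot> i = Ident C (Dom C u')"
    by (rule is_pullback_eq[OF assms(2)]) (use i j p p' in \<open>auto simp: assoc\<close>)
  ultimately have "is_iso C i"
    unfolding is_iso_def using i j by (auto simp: hom_def)
  with i that show thesis by auto
qed

text \<open>Together with \<open>is_pullback_unique\<close> this carries what is known of one
  pullback over to every other pullback of the same cospan.\<close>

lemma is_pullback_iso:
  assumes pb: "is_pullback C u v f g" and "is_iso C i" "Cod C i = Dom C u"
  shows "is_pullback C (i \<cdot> u) (i \<cdot> v) f g"
proof -
  note p = is_pullbackD[OF pb]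
  have i: "i \<in> Arr C" using assms by (auto simp: is_iso_def)
  obtain j where j: "j \<in> Arr C" "Dom C j = Dom C u" "Cod C j = Dom C i" "i \<cdot> j = Ident C (Dom C i)"
    "j \<cdot> i = Ident C (Dom C u)"
    using assms by (auto simp: is_iso_def hom_def)
  have *: "\<exists>!t. t \<in> hom C W (Dom C (i \<cdot> u)) \<and> t \<cdot> (i \<cdot> u) = x \<and> t \<cdot> (i \<cdot> v) = y"
    if x: "x \<in> hom C W (Dom C f)" and y: "y \<in> hom C W (Dom C g)" and e: "x \<cdot> f = y \<cdot> g" for W x y
  proof -
    obtain t where t: "t \<in> Arr C" "Dom C t = W" "Cod C t = Dom C u" "t \<cdot> u = x" "t \<cdot> v = y"
      using is_pullback_lift[OF pb, of x y] x y e by (auto simp: hom_def)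
    have ji: "j \<cdot> (i \<cdot> w) = w" if "w \<in> Arr C" "Dom C w = Dom C u" for w
      using assoc[of j i w] that i j assms(3) by auto
    show ?thesis
    proof (rule ex1I[of _ "t \<cdot> j"])
      show "t \<cdot> j \<in> hom C W (Dom C (i \<cdot> u)) \<and> t \<cdot> j \<cdot> (i \<cdot> u) = x \<and> t \<cdot> j \<cdot> (i \<cdot> v) = y"
        using t i j p assms(3) by (auto simp: hom_def assoc ji)
    next
      fix s assume s: "s \<in> hom C W (Dom C (i \<cdot> u)) \<and> s \<cdot> (i \<cdot> u) = x \<and> s \<cdot> (i \<cdot> v) = y"
      then have s': "s \<in> Arr C" "Dom C s = W" "Cod C s = Dom C i" using i p assms(3) by (auto simp: hom_def)
      have "s \<cdot> i = t"
        by (rule is_pullback_eq[OF pb]) (use s s' t i p assms(3) in \<open>auto simp: assoc\<close>)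
      then have "t \<cdot> j = s \<cdot> (i \<cdot> j)" using s' i j assms(3) by (auto simp: assoc)
      then show "s = t \<cdot> j" using s' j by auto
    qed
  qed
  show ?thesis
    unfolding is_pullback_def using p i j assms(3) * by (auto simp: hom_def assoc)
qed

end

context cat_functor
begin

lemma AMap_type [simp]:
  assumes "f \<in> Arr C"
  shows "AMap F f \<in> Arr D" "Dom D (AMap F f) = OMap F (Dom C f)" "Cod D (AMap F f) = OMap F (Cod C f)"
  using AMap_in_hom[of f "Dom C f" "Cod C f"] assms by (auto simp: hom_def)

lemma AMap_Comp':
  "f \<in> Arr C \<Longrightarrow> g \<in> Arr C \<Longrightarrow> Cod C f = Dom C g \<Longrightarrow> AMap F (f \<cdot>\<^bsub>C\<^esub> g) = AMap F f \<cdot>\<^bsub>D\<^esub> AMap F g"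
  using AMap_Comp[of f "Dom C f" "Cod C f" g "Cod C g"] by (auto simp: hom_def)

declare OMap_in_Obj [simp]

lemma AMap_is_iso:
  assumes "is_iso C f" shows "is_iso D (AMap F f)"
proof -
  have f: "f \<in> Arr C" using assms by (auto simp: is_iso_def)
  obtain g where g: "g \<in> Arr C" "Dom C g = Cod C f" "Cod C g = Dom C f"
    "f \<cdot>\<^bsub>C\<^esub> g = Ident C (Dom C f)" "g \<cdot>\<^bsub>C\<^esub> f = Ident C (Cod C f)"
    using assms by (auto simp: is_iso_def hom_def)
  have "AMap F f \<cdot>\<^bsub>D\<^esub> AMap F g = Ident D (OMap F (Dom C f))"
    "AMap F g \<cdot>\<^bsub>D\<^esub> AMap F f = Ident D (OMap F (Cod C f))"
    using f g by (auto simp flip: AMap_Comp' simp: AMap_Ident)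
  then show ?thesis unfolding is_iso_def using f g by (intro conjI bexI[of _ "AMap F g"]) (auto simp: hom_def)
qed

end


section \<open>Total maps of a restriction category\<close>

context restriction_category
begin

lemma Rst_type [simp]:
  assumes "f \<in> Arr C"
  shows "Rst C f \<in> Arr C" "Dom C (Rst C f) = Dom C f" "Cod C (Rst C f) = Dom C f"
  using Rst_in_hom[of f "Dom C f" "Cod C f"] assms by (auto simp: hom_def)

lemma Rst_Ident [simp]:
  assumes "X \<in> Obj C" shows "Rst C (Ident C X) = Ident C X"
  using R1[of "Ident C X"] assms by auto

lemma Rst_commute: "f \<in> Arr C \<Longrightarrow> g \<in> Arr C \<Longrightarrow> Dom C f = Dom C g \<Longrightarrow> Rst C f \<cdot> Rst C g = Rst C g \<cdot> Rst C f"
  using R2[of f "Dom C f" "Cod C f" g "Cod C g"] by (auto simp: hom_def)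

lemma Rst_Rst_Comp: "f \<in> Arr C \<Longrightarrow> g \<in> Arr C \<Longrightarrow> Dom C f = Dom C g \<Longrightarrow> Rst C (Rst C f \<cdot> g) = Rst C f \<cdot> Rst C g"
  using R3[of f "Dom C f" "Cod C f" g "Cod C g"] by (auto simp: hom_def)

lemma Comp_Rst: "f \<in> Arr C \<Longrightarrow> g \<in> Arr C \<Longrightarrow> Cod C f = Dom C g \<Longrightarrow> f \<cdot> Rst C g = Rst C (f \<cdot> g) \<cdot> f"
  using R4[of f "Dom C f" "Cod C f" g "Cod C g"] by (auto simp: hom_def)

lemma Rst_Rst [simp]:
  assumes "f \<in> Arr C" shows "Rst C (Rst C f) = Rst C f"
  using Rst_Rst_Comp[of f "Ident C (Dom C f)"] assms by auto

text \<open>In the order of restriction idempotents: a composite is defined only where its first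
  factor is.\<close>

lemma Rst_Comp_Rst_dom:
  assumes "f \<in> Arr C" "g \<in> Arr C" "Cod C f = Dom C g"
  shows "Rst C f \<cdot> Rst C (f \<cdot> g) = Rst C (f \<cdot> g)"
  using Rst_Rst_Comp[of f "f \<cdot> g"] assms assoc[of "Rst C f" f g] R1[of f] by auto

lemma Rst_Comp_Rst:
  assumes "f \<in> Arr C" "g \<in> Arr C" "Cod C f = Dom C g"
  shows "Rst C (f \<cdot> Rst C g) = Rst C (f \<cdot> g)"
proof -
  have "Rst C (f \<cdot> Rst C g) = Rst C (Rst C (f \<cdot> g) \<cdot> f)" using assms by (simp add: Comp_Rst)
  also have "\<dots> = Rst C (f \<cdot> g) \<cdot> Rst C f" using assms by (simp add: Rst_Rst_Comp)
  also have "\<dots> = Rst C f \<cdot> Rst C (f \<cdot> g)" using assms by (simp add: Rst_commute)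
  finally show ?thesis using assms by (simp add: Rst_Comp_Rst_dom)
qed

lemma total_map_Arr: "total_map C f \<Longrightarrow> f \<in> Arr C"
  by (simp add: total_map_def)

lemma total_map_Rst: "total_map C f \<Longrightarrow> Rst C f = Ident C (Dom C f)"
  by (simp add: total_map_def)

lemma total_map_Ident: "X \<in> Obj C \<Longrightarrow> total_map C (Ident C X)"
  by (simp add: total_map_def)

lemma Rst_Comp_total:
  assumes "f \<in> Arr C" "total_map C g" "Cod C f = Dom C g"
  shows "Rst C (f \<cdot> g) = Rst C f"
  using Rst_Comp_Rst[of f g] assms by (auto simp: total_map_def)

lemma total_map_Comp:
  assumes "total_map C f" "total_map C g" "Cod C f = Dom C g"
  shows "total_map C (f \<cdot> g)"
  using Rst_Comp_total[of f g] assms by (auto simp: total_map_def)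

text \<open>Mediating arrows are built below with partial retractions. They are recognised as total
  from a composite that is already known to be total.\<close>

lemma total_map_cancel:
  assumes "f \<in> Arr C" "g \<in> Arr C" "Cod C f = Dom C g" "total_map C (f \<cdot> g)"
  shows "total_map C f"
  using Rst_Comp_Rst_dom[of f g] assms by (auto simp: total_map_def)

lemma section_total:
  assumes "m \<in> Arr C" "r \<in> Arr C" "Cod C m = Dom C r" "m \<cdot> r = Ident C X" "X \<in> Obj C"
  shows "total_map C m"
  using total_map_cancel[of m r] total_map_Ident[of X] assms by auto

lemma restriction_idempotent_Rst: "f \<in> Arr C \<Longrightarrow> restriction_idempotent C (Rst C f)"
  by (auto simp: restriction_idempotent_def hom_def)

text \<open>The half \<open>m\<close> is a section, hence total, so composing with it does not
  change the restriction of \<open>r\<close>. Thus \<open>r\<close> witnesses that \<open>m\<close>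
  is a restriction monic.\<close>

lemma splits_RstE:
  assumes "splits C (Rst C f)" "f \<in> Arr C"
  obtains r m where "r \<in> Arr C" "m \<in> Arr C" "Dom C r = Cod C m" "Cod C r = Dom C m" "Cod C m = Dom C f"
    "m \<cdot> r = Ident C (Dom C m)" "r \<cdot> m = Rst C f" "Rst C r = Rst C f"
proof -
  obtain r m where rm: "r \<in> Arr C" "m \<in> Arr C" "Dom C r = Cod C m" "Cod C r = Dom C m" "Rst C f = r \<cdot> m"
    "m \<cdot> r = Ident C (Dom C m)"
    using assms(1) unfolding splits_def hom_def by auto
  have "total_map C m" using section_total[of m r "Dom C m"] rm by auto
  then have "Rst C r = Rst C (Rst C f)"
    using Rst_Comp_total[of r m] rm by simp
  then have "Rst C r = Rst C f" using assms(2) by simp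
  moreover have "Cod C m = Dom C f" using rm(1-4) rm(5)[symmetric] assms(2) by (metis Comp_type(2) Rst_type(2))
  ultimately show thesis using that[of r m] rm by simp
qed

lemma restriction_monicE:
  assumes "restriction_monic C m"
  obtains r where "m \<in> Arr C" "r \<in> Arr C" "Dom C r = Cod C m" "Cod C r = Dom C m"
    "m \<cdot> r = Ident C (Dom C m)" "r \<cdot> m = Rst C r" "total_map C m"
proof -
  obtain r where r: "m \<in> Arr C" "r \<in> Arr C" "Dom C r = Cod C m" "Cod C r = Dom C m"
    "m \<cdot> r = Ident C (Dom C m)" "r \<cdot> m = Rst C r"
    using assms by (auto simp: restriction_monic_def hom_def)
  then show thesis using that section_total[of m r "Dom C m"] by auto
qed

lemma restriction_monicI:
  assumes "m \<in> Arr C" "r \<in> Arr C" "Dom C r = Cod C m" "Cod C r = Dom C m"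
    "m \<cdot> r = Ident C (Dom C m)" "r \<cdot> m = Rst C r"
  shows "restriction_monic C m"
  using assms by (auto simp: restriction_monic_def hom_def)

lemma restriction_monic_total: "restriction_monic C m \<Longrightarrow> total_map C m"
  by (erule restriction_monicE)

section \<open>The M-category of total maps\<close>

lemma Total_mcat_simps [simp]:
  "Obj (Total_mcat C) = Obj C" "Arr (Total_mcat C) = {f. total_map C f}" "Dom (Total_mcat C) = Dom C"
  "Cod (Total_mcat C) = Cod C" "Ident (Total_mcat C) = Ident C" "f \<cdot>\<^bsub>Total_mcat C\<^esub> g = f \<cdot> g"
  "Mon (Total_mcat C) = {m. restriction_monic C m}"
  by (auto simp: Total_mcat_def total_map_def restriction_monic_def)

lemma hom_Total_mcat: "hom (Total_mcat C) X Y = {f \<in> hom C X Y. total_map C f}"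
  by (auto simp: hom_def total_map_Arr)

lemma category_Total_mcat: "category (Total_mcat C)"
  by unfold_locales
    (auto simp: hom_def total_map_Arr total_map_Ident total_map_Comp assoc)

lemma is_iso_restriction_monic:
  assumes "is_iso (Total_mcat C) f" shows "restriction_monic C f"
proof -
  obtain g where "total_map C f" "total_map C g" "Dom C g = Cod C f" "Cod C g = Dom C f"
    "f \<cdot> g = Ident C (Dom C f)" "g \<cdot> f = Ident C (Cod C f)"
    using assms by (auto simp: is_iso_def hom_Total_mcat hom_def)
  then show ?thesis
    by (auto intro!: restriction_monicI[of f g] simp: total_map_Arr total_map_Rst)
qed

lemma restriction_monic_Comp:
  assumes "restriction_monic C m" "restriction_monic C n" "Cod C m = Dom C n"
  shows "restriction_monic C (m \<cdot> n)"
proof -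
  obtain r where r: "m \<in> Arr C" "r \<in> Arr C" "Dom C r = Cod C m" "Cod C r = Dom C m"
    "m \<cdot> r = Ident C (Dom C m)" "r \<cdot> m = Rst C r"
    using restriction_monicE[OF assms(1)] by metis
  obtain s where s: "n \<in> Arr C" "s \<in> Arr C" "Dom C s = Cod C n" "Cod C s = Dom C n"
    "n \<cdot> s = Ident C (Dom C n)" "s \<cdot> n = Rst C s"
    using restriction_monicE[OF assms(2)] by metis
  have "(m \<cdot> n) \<cdot> (s \<cdot> r) = m \<cdot> ((n \<cdot> s) \<cdot> r)" using r s(1-4) assms(3) by (simp add: assoc)
  then have 1: "(m \<cdot> n) \<cdot> (s \<cdot> r) = Ident C (Dom C m)" using r s assms(3) by simp
  have "(s \<cdot> r) \<cdot> (m \<cdot> n) = (s \<cdot> (r \<cdot> m)) \<cdot> n" using r(1-5) s(1-4) assms(3) by (simp add: assoc)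
  \<comment> \<open>As \<open>r m\<close> is the restriction of \<open>r\<close>, axiom R4 moves it
    to the left past \<open>s\<close>.\<close>
  also have "\<dots> = Rst C (s \<cdot> r) \<cdot> (s \<cdot> n)" using r s(1-4) assms(3) by (simp add: Comp_Rst assoc)
  also have "\<dots> = Rst C s \<cdot> Rst C (s \<cdot> r)" using r s assms(3) by (simp add: Rst_commute)
  also have "\<dots> = Rst C (s \<cdot> r)" using r s assms(3) by (simp add: Rst_Comp_Rst_dom)
  finally show ?thesis
    using 1 r s assms(3) by (auto intro!: restriction_monicI[of _ "s \<cdot> r"])
qed

text \<open>The mediating arrow for \<open>x\<close> and \<open>y\<close> is \<open>x s\<close>,
  because \<open>s\<close> inverts \<open>n\<close> on the part of the domain of \<open>f\<close>
  where \<open>f r\<close> is defined. The hypotheses are kept as bare equations about chosen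
  \<open>r\<close> and \<open>s\<close> so that the lemma applies equally to the image of such data
  under a restriction functor.\<close>

lemma is_pullback_Total_mcat:
  assumes m: "m \<in> Arr C" "r \<in> Arr C" "Dom C r = Cod C m" "Cod C r = Dom C m"
      "m \<cdot> r = Ident C (Dom C m)" "r \<cdot> m = Rst C r"
    and f: "total_map C f" "Cod C f = Cod C m"
    and n: "n \<in> Arr C" "s \<in> Arr C" "Dom C s = Cod C n" "Cod C s = Dom C n" "Cod C n = Dom C f"
      "n \<cdot> s = Ident C (Dom C n)" "s \<cdot> n = Rst C (f \<cdot> r)"
  shows "is_pullback (Total_mcat C) n (n \<cdot> (f \<cdot> r)) f m"
proof -
  note fA = total_map_Arr[OF f(1)]
  have mt: "total_map C m" using section_total[of m r "Dom C m"] m by auto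
  have nt: "total_map C n" using section_total[of n s "Dom C n"] n by auto
  have "(n \<cdot> (f \<cdot> r)) \<cdot> m = n \<cdot> (f \<cdot> Rst C r)" using m f(2) fA n by (simp add: assoc)
  also have "\<dots> = n \<cdot> ((s \<cdot> n) \<cdot> f)" using m f(2) fA n by (simp add: Comp_Rst)
  also have "\<dots> = (n \<cdot> s) \<cdot> (n \<cdot> f)" using m f(2) fA n(1-5) by (simp add: assoc)
  finally have sq: "(n \<cdot> (f \<cdot> r)) \<cdot> m = n \<cdot> f" using m f(2) fA n by simp
  have vt: "total_map C (n \<cdot> (f \<cdot> r))"
    by (rule total_map_cancel[of _ m])
      (use m f(2) fA n(1-5) sq total_map_Comp[OF nt f(1)] in auto)
  have lift: "\<exists>!t. t \<in> hom (Total_mcat C) W (Dom C n) \<and> t \<cdot> n = x \<and> t \<cdot> (n \<cdot> (f \<cdot> r)) = y"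
    if "x \<in> hom (Total_mcat C) W (Dom C f)" "y \<in> hom (Total_mcat C) W (Dom C m)" and e: "x \<cdot> f = y \<cdot> m" for W x y
  proof -
    have x: "x \<in> Arr C" "total_map C x" "Dom C x = W" "Cod C x = Dom C f"
      and y: "y \<in> Arr C" "total_map C y" "Dom C y = W" "Cod C y = Dom C m"
      using that by (auto simp: hom_def total_map_Arr)
    have xfr: "x \<cdot> (f \<cdot> r) = y"
    proof -
      have "x \<cdot> (f \<cdot> r) = (x \<cdot> f) \<cdot> r" using x fA f(2) m by (simp add: assoc)
      also have "\<dots> = y \<cdot> (m \<cdot> r)" using e y m(1-4) by (simp add: assoc)
      finally show ?thesis using y m by simp
    qed
    \<comment> \<open>The idempotent acts trivially on \<open>x\<close>: R4 turns it into the
      restriction of \<open>x f r\<close>, which is \<open>y\<close>, and \<open>y\<close> is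
      total.\<close>
    have "(x \<cdot> s) \<cdot> n = x \<cdot> Rst C (f \<cdot> r)" using x n by (simp add: assoc)
    also have "\<dots> = Rst C y \<cdot> x" using x fA f(2) m by (simp add: Comp_Rst xfr)
    finally have tn: "(x \<cdot> s) \<cdot> n = x" using x y by (simp add: total_map_Rst)
    have tt: "total_map C (x \<cdot> s)"
      by (rule total_map_cancel[of _ n]) (use x n tn in auto)
    show ?thesis
    proof (rule ex1I[of _ "x \<cdot> s"], intro conjI)
      show "x \<cdot> s \<in> hom (Total_mcat C) W (Dom C n)"
        using x n tt by (auto simp: hom_def)
      show "x \<cdot> s \<cdot> (n \<cdot> (f \<cdot> r)) = y"
        using assoc[of "x \<cdot> s" n "f \<cdot> r"] x n m f fA xfr tn by auto
    next
      fix t assume t: "t \<in> hom (Total_mcat C) W (Dom C n) \<and> t \<cdot> n = x \<and> t \<cdot> (n \<cdot> (f \<cdot> r)) = y"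
      then have "t \<in> Arr C" "Cod C t = Dom C n" by (auto simp: hom_def total_map_Arr)
      \<comment> \<open>Since \<open>n s\<close> is an identity, \<open>t\<close> is already
        determined by \<open>t n\<close>.\<close>
      then show "t = x \<cdot> s" using t n(1-6) assoc[of t n s] by auto
    qed (rule tn)
  qed
  show ?thesis
    unfolding is_pullback_def
    using m f fA n mt nt vt sq lift by (auto simp: hom_Total_mcat hom_def)
qed

end

text \<open>The restriction of \<open>f r\<close> plays the role of the inverse image of
  \<open>m\<close> under \<open>f\<close>; splitting it turns this partial identity into a
  subobject.\<close>

lemma (in r_split_category) splitting_pullback:
  assumes m: "restriction_monic C m" and f: "total_map C f" "Cod C f = Cod C m"
  obtains n s r where "m \<in> Arr C" "r \<in> Arr C" "Dom C r = Cod C m" "Cod C r = Dom C m"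
      "m \<cdot> r = Ident C (Dom C m)" "r \<cdot> m = Rst C r"
      "n \<in> Arr C" "s \<in> Arr C" "Dom C s = Cod C n" "Cod C s = Dom C n" "Cod C n = Dom C f"
      "n \<cdot> s = Ident C (Dom C n)" "s \<cdot> n = Rst C (f \<cdot> r)" "restriction_monic C n"
      "is_pullback (Total_mcat C) n (n \<cdot> (f \<cdot> r)) f m"
proof -
  obtain r where r: "m \<in> Arr C" "r \<in> Arr C" "Dom C r = Cod C m" "Cod C r = Dom C m"
    "m \<cdot> r = Ident C (Dom C m)" "r \<cdot> m = Rst C r"
    using restriction_monicE[OF m] by metis
  have fr: "f \<cdot> r \<in> Arr C" "Dom C (f \<cdot> r) = Dom C f" using r f by (auto simp: total_map_Arr)
  obtain s n where sn: "s \<in> Arr C" "n \<in> Arr C" "Dom C s = Cod C n" "Cod C s = Dom C n" "Cod C n = Dom C (f \<cdot> r)"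
    "n \<cdot> s = Ident C (Dom C n)" "s \<cdot> n = Rst C (f \<cdot> r)" "Rst C s = Rst C (f \<cdot> r)"
    by (rule splits_RstE[OF restriction_idempotents_split[OF restriction_idempotent_Rst[OF fr(1)]] fr(1)])
  note sn = sn[unfolded fr(2)]
  have "restriction_monic C n" using sn by (auto intro!: restriction_monicI[of n s])
  moreover have "is_pullback (Total_mcat C) n (n \<cdot> (f \<cdot> r)) f m"
    using sn by (intro is_pullback_Total_mcat[OF r f, of n s]) auto
  ultimately show thesis using that[OF r, of n s] sn by auto
qed

text \<open>Stability is required of every pullback, whereas only the split one is known to have a
  restriction monic as projection. The two projections differ by an isomorphism, which is itself a
  restriction monic.\<close>

lemma (in r_split_category) m_category_Total_mcat: "m_category (Total_mcat C)"
proof -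
  interpret TC: category "Total_mcat C" by (rule category_Total_mcat)
  show ?thesis
  proof
    fix m assume "m \<in> Mon (Total_mcat C)"
    then have m: "restriction_monic C m" by simp
    obtain r where "m \<in> Arr C" "r \<in> Arr C" "Dom C r = Cod C m" "m \<cdot> r = Ident C (Dom C m)"
      using restriction_monicE[OF m] by metis
    then have "monic C m" using split_mono_monic by auto
    then show "monic (Total_mcat C) m"
      using restriction_monic_total[OF m] by (auto simp: monic_def hom_Total_mcat)
  next
    fix m f assume "m \<in> Mon (Total_mcat C)" "f \<in> Arr (Total_mcat C)" "Cod (Total_mcat C) f = Cod (Total_mcat C) m"
    then show "\<exists>u v. is_pullback (Total_mcat C) u v f m"
      using splitting_pullback[of m f] by (metis Total_mcat_simps(2,4,7) mem_Collect_eq)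
  next
    fix m u v f assume m: "m \<in> Mon (Total_mcat C)" and pb: "is_pullback (Total_mcat C) u v f m"
    obtain n w where n: "restriction_monic C n" "is_pullback (Total_mcat C) n w f m"
      using splitting_pullback[of m f] m TC.is_pullbackD[OF pb]
      by (metis Total_mcat_simps(2,4,7) mem_Collect_eq)
    obtain i where i: "is_iso (Total_mcat C) i" "Cod C i = Dom C n" "u = i \<cdot> n"
      using TC.is_pullback_unique[OF pb n(2)] by auto
    then show "u \<in> Mon (Total_mcat C)"
      using restriction_monic_Comp[OF is_iso_restriction_monic n(1)] by auto
  qed (auto simp: is_iso_restriction_monic restriction_monic_Comp)
qed

section \<open>Functors induced on total maps\<close>

context restriction_functor
begin

lemma AMap_total: "total_map E f \<Longrightarrow> total_map B (AMap p f)"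
  using AMap_Rst[of f] by (auto simp: total_map_def AMap_Ident)

lemma AMap_restriction_monic:
  assumes "restriction_monic E m" shows "restriction_monic B (AMap p m)"
proof -
  obtain r where r: "m \<in> Arr E" "r \<in> Arr E" "Dom E r = Cod E m" "Cod E r = Dom E m"
    "m \<cdot>\<^bsub>E\<^esub> r = Ident E (Dom E m)" "r \<cdot>\<^bsub>E\<^esub> m = Rst E r"
    using source.restriction_monicE[OF assms] by metis
  show ?thesis
    by (rule target.restriction_monicI[of _ "AMap p r"])
      (use r in \<open>auto simp flip: AMap_Comp' AMap_Rst simp: AMap_Ident\<close>)
qed

lemma cat_functor_Total_mcat: "cat_functor (Total_mcat E) (Total_mcat B) p"
proof -
  interpret TE: category "Total_mcat E" by (rule source.category_Total_mcat)
  interpret TB: category "Total_mcat B" by (rule target.category_Total_mcat)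
  show ?thesis
    by unfold_locales
      (auto simp: hom_def AMap_total AMap_Ident AMap_Comp' source.total_map_Arr)
qed

end

context r_split_functor
begin

text \<open>The universal property of a given pullback says nothing about its image. So it is first
  compared with the split pullback, whose image is a pullback by its equations, and the comparison
  isomorphism is then mapped along.\<close>

lemma m_functor_Total_mcat: "m_functor (Total_mcat E) (Total_mcat B) p"
proof -
  interpret TE: m_category "Total_mcat E" by (rule source.m_category_Total_mcat)
  interpret TB: m_category "Total_mcat B" by (rule target.m_category_Total_mcat)
  interpret Tp: cat_functor "Total_mcat E" "Total_mcat B" p by (rule cat_functor_Total_mcat)
  show ?thesis
  proof
    fix m u v f assume m: "m \<in> Mon (Total_mcat E)" and pb: "is_pullback (Total_mcat E) u v f m"
    note d = TE.is_pullbackD[OF pb]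
    then have f: "f \<in> Arr E" "total_map E f" "Cod E f = Cod E m" by (auto simp: source.total_map_Arr)
    obtain n s r where r: "m \<in> Arr E" "r \<in> Arr E" "Dom E r = Cod E m" "Cod E r = Dom E m"
      "m \<cdot>\<^bsub>E\<^esub> r = Ident E (Dom E m)" "r \<cdot>\<^bsub>E\<^esub> m = Rst E r"
      and n: "n \<in> Arr E" "s \<in> Arr E" "Dom E s = Cod E n" "Cod E s = Dom E n" "Cod E n = Dom E f"
      "n \<cdot>\<^bsub>E\<^esub> s = Ident E (Dom E n)" "s \<cdot>\<^bsub>E\<^esub> n = Rst E (f \<cdot>\<^bsub>E\<^esub> r)"
      and pbn: "is_pullback (Total_mcat E) n (n \<cdot>\<^bsub>E\<^esub> (f \<cdot>\<^bsub>E\<^esub> r)) f m"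
      using source.splitting_pullback[of m f] m f by (metis source.Total_mcat_simps(7) mem_Collect_eq)
    obtain i where i: "is_iso (Total_mcat E) i" "total_map E i" "Cod E i = Dom E n" "u = i \<cdot>\<^bsub>E\<^esub> n"
      "v = i \<cdot>\<^bsub>E\<^esub> (n \<cdot>\<^bsub>E\<^esub> (f \<cdot>\<^bsub>E\<^esub> r))"
      using TE.is_pullback_unique[OF pb pbn] by auto
    note iA = source.total_map_Arr[OF i(2)]
    have "is_pullback (Total_mcat B) (AMap p n) (AMap p n \<cdot>\<^bsub>B\<^esub> (AMap p f \<cdot>\<^bsub>B\<^esub> AMap p r)) (AMap p f) (AMap p m)"
      by (rule target.is_pullback_Total_mcat[of _ "AMap p r" _ _ "AMap p s"])
        (use r n f in \<open>auto simp flip: AMap_Comp' AMap_Rst simp: AMap_Ident AMap_total\<close>)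
    from TB.is_pullback_iso[OF this Tp.AMap_is_iso[OF i(1)]]
    show "is_pullback (Total_mcat B) (AMap p u) (AMap p v) (AMap p f) (AMap p m)"
      using i iA r(1-4) n(1-5) f by (simp add: AMap_Comp')
  qed (auto simp: AMap_restriction_monic)
qed

end

section \<open>From latent fibrations to M-fibrations\<close>

lemma prone_lift_unique:
  assumes "prone E B p f'" "g \<in> hom E Y (Cod E f')" "h \<in> hom B (OMap p Y) (OMap p (Dom E f'))"
    "precise_triangle B h (AMap p f') (AMap p g)"
  shows "\<exists>!k. k \<in> hom E Y (Dom E f') \<and> AMap p k = h \<and> precise_triangle E k f' g"
  using assms unfolding prone_def by auto

context r_split_latent_fibration
begin

text \<open>A prone arrow over a total map need not be total, but its domain idempotent lies in a fibre;
  restricting to the splitting of that idempotent gives a cartesian total map.\<close>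

lemma cartesian_Total_mcat:
  assumes X: "X \<in> Obj E" and f: "total_map B f" "Cod B f = OMap p X"
  shows "\<exists>f'. total_map E f' \<and> Cod E f' = X \<and> cartesian (Total_mcat E) (Total_mcat B) p f' \<and> AMap p f' = f"
proof -
  have fA: "f \<in> Arr B" using f by (simp add: target.total_map_Arr)
  obtain f' where f': "f' \<in> Arr E" "Cod E f' = X" "prone E B p f'" "AMap p f' = f"
    using prone_lift[of X f "Dom B f"] X f fA by (auto simp: hom_def)
  let ?A = "OMap p (Dom E f')"
  let ?e = "Rst E f'"
  \<comment> \<open>The functor preserves restrictions and \<open>f\<close> is total, so the domain
    idempotent of the lift becomes trivial in the base.\<close>
  have pe: "AMap p ?e = Ident B ?A"
    using f' f AMap_Rst[of f'] AMap_type[of f'] by (auto simp: target.total_map_Rst)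
  have ri: "restriction_idempotent E ?e" using f' source.restriction_idempotent_Rst by simp
  have "restriction_idempotent (fibre E B p ?A) ?e"
    using f' pe by (auto simp: restriction_idempotent_def fibre_def hom_def)
  moreover have "splits E ?e" by (rule source.restriction_idempotents_split[OF ri])
  ultimately have "splits (fibre E B p ?A) ?e"
    using well_fibred f' unfolding well_fibred_def by auto
  then obtain r m where rm: "r \<in> Arr E" "m \<in> Arr E" "Dom E r = Cod E m" "Cod E r = Dom E m"
    "?e = r \<cdot>\<^bsub>E\<^esub> m" "m \<cdot>\<^bsub>E\<^esub> r = Ident E (Dom E m)" "AMap p r = Ident B ?A" "AMap p m = Ident B ?A"
    and ob: "OMap p (Dom E m) = ?A"
    unfolding splits_def fibre_def hom_def by auto
  have Dr: "Dom E r = Dom E f'" using rm f' by (metis source.Comp_type(2) source.Rst_type(2))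
  have mt: "total_map E m" using source.section_total[of m r "Dom E m"] rm by auto
  \<comment> \<open>Totality comes from \<open>m\<close> absorbing the idempotent that it splits:
    \<open>m (r m) = m\<close>.\<close>
  have "Rst E (m \<cdot>\<^bsub>E\<^esub> f') = Rst E (m \<cdot>\<^bsub>E\<^esub> (r \<cdot>\<^bsub>E\<^esub> m))"
    using source.Rst_Comp_Rst[of m f'] rm(1-5) f' Dr by simp
  also have "\<dots> = Rst E m"
    using source.assoc[of m r m] rm(1-4,6) by simp
  finally have ct: "total_map E (m \<cdot>\<^bsub>E\<^esub> f')"
    using mt f' rm(1-4) Dr by (simp add: total_map_def)
  have pc: "AMap p (m \<cdot>\<^bsub>E\<^esub> f') = f"
    using rm(1-4,7,8) Dr f' AMap_type(2)[of f'] fA by (simp add: AMap_Comp')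
  have ar: "k \<cdot>\<^bsub>E\<^esub> (r \<cdot>\<^bsub>E\<^esub> (m \<cdot>\<^bsub>E\<^esub> f')) = k \<cdot>\<^bsub>E\<^esub> f'" if "k \<in> Arr E" "Cod E k = Dom E f'" for k
    using that rm(1-5) Dr f' source.assoc[of r m f'] by (simp add: source.R1 flip: rm(5))
  \<comment> \<open>As \<open>r\<close> and \<open>m\<close> lie over identities, factorizations
    through \<open>f'\<close> and through \<open>m f'\<close> over the same \<open>h\<close>
    correspond: \<open>k\<close> goes to \<open>k r\<close>, and \<open>l\<close> goes to
    \<open>l m\<close>.\<close>
  have cart: "\<exists>!k. k \<in> hom (Total_mcat E) Y (Dom E m) \<and> AMap p k = h \<and> k \<cdot>\<^bsub>E\<^esub> (m \<cdot>\<^bsub>E\<^esub> f') = g"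
    if "g \<in> hom (Total_mcat E) Y X" "h \<in> hom (Total_mcat B) (OMap p Y) ?A" "h \<cdot>\<^bsub>B\<^esub> f = AMap p g" for Y g h
  proof -
    have g: "g \<in> Arr E" "total_map E g" "Dom E g = Y" "Cod E g = X"
      and h: "h \<in> Arr B" "total_map B h" "Dom B h = OMap p Y" "Cod B h = ?A"
      using that by (auto simp: hom_def source.total_map_Arr target.total_map_Arr)
    have hf: "Dom B f = ?A" using f' AMap_type(2)[of f'] by simp
    \<comment> \<open>A commuting triangle of total maps is automatically precise, so proneness
      applies.\<close>
    have "precise_triangle B h f (AMap p g)"
      using g h that(3) fA hf AMap_total[OF g(2)]
      by (auto simp: precise_triangle_def hom_def target.total_map_Rst)
    then have ex: "\<exists>!k. k \<in> hom E Y (Dom E f') \<and> AMap p k = h \<and> precise_triangle E k f' g"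
      using prone_lift_unique[OF f'(3), of g Y h] f' g h by (auto simp: hom_def)
    obtain k where kp: "k \<in> hom E Y (Dom E f') \<and> AMap p k = h \<and> precise_triangle E k f' g"
      by (rule ex1E[OF ex])
    then have k: "k \<in> Arr E" "Dom E k = Y" "Cod E k = Dom E f'" "AMap p k = h" "k \<cdot>\<^bsub>E\<^esub> f' = g"
      unfolding hom_def precise_triangle_def by blast+
    have krg: "(k \<cdot>\<^bsub>E\<^esub> r) \<cdot>\<^bsub>E\<^esub> (m \<cdot>\<^bsub>E\<^esub> f') = g"
      using k rm(1-4) Dr f' ar[of k] by (simp add: source.assoc)
    have krt: "total_map E (k \<cdot>\<^bsub>E\<^esub> r)"
      by (rule source.total_map_cancel[of _ "m \<cdot>\<^bsub>E\<^esub> f'"]) (use k rm(1-4) Dr f' krg g in auto)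
    show ?thesis
    proof (rule ex1I[of _ "k \<cdot>\<^bsub>E\<^esub> r"], intro conjI)
      show "k \<cdot>\<^bsub>E\<^esub> r \<in> hom (Total_mcat E) Y (Dom E m)" using krt k rm(1-4) Dr by (auto simp: hom_def)
      show "AMap p (k \<cdot>\<^bsub>E\<^esub> r) = h" using k rm(1-4,7) Dr h by (simp add: AMap_Comp')
    next
      fix l assume l: "l \<in> hom (Total_mcat E) Y (Dom E m) \<and> AMap p l = h \<and> l \<cdot>\<^bsub>E\<^esub> (m \<cdot>\<^bsub>E\<^esub> f') = g"
      then have lA: "l \<in> Arr E" "total_map E l" "Dom E l = Y" "Cod E l = Dom E m"
        by (auto simp: hom_def source.total_map_Arr)
      have "total_map E (l \<cdot>\<^bsub>E\<^esub> m)" by (rule source.total_map_Comp) (use lA mt in auto)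
      moreover have "(l \<cdot>\<^bsub>E\<^esub> m) \<cdot>\<^bsub>E\<^esub> f' = g" using l lA rm(1-4) Dr f' by (simp add: source.assoc)
      moreover have "AMap p (l \<cdot>\<^bsub>E\<^esub> m) = h" using l lA rm(1-4,8) h by (simp add: AMap_Comp')
      ultimately have "l \<cdot>\<^bsub>E\<^esub> m \<in> hom E Y (Dom E f') \<and> AMap p (l \<cdot>\<^bsub>E\<^esub> m) = h \<and> precise_triangle E (l \<cdot>\<^bsub>E\<^esub> m) f' g"
        using lA g rm(1-4) Dr f' by (auto simp: precise_triangle_def hom_def source.total_map_Rst)
      then have "l \<cdot>\<^bsub>E\<^esub> m = k" using ex kp by blast
      then show "l = k \<cdot>\<^bsub>E\<^esub> r" using source.assoc[of l m r] lA rm(1-4,6) by auto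
    qed (rule krg)
  qed
  show ?thesis
    using ct pc cart ob rm(1-4) Dr f'
    by (intro exI[of _ "m \<cdot>\<^bsub>E\<^esub> f'"]) (auto simp: cartesian_def)
qed

lemma m_plentiful_Total_mcat: "m_plentiful (Total_mcat E) (Total_mcat B) p"
  unfolding m_plentiful_def
proof (intro ballI impI)
  fix X m assume X: "X \<in> Obj (Total_mcat E)" and "m \<in> Mon (Total_mcat B)" and md: "Dom (Total_mcat B) m = OMap p X"
  then have "restriction_monic B m" by simp
  then obtain r where r: "m \<in> Arr B" "r \<in> Arr B" "Dom B r = Cod B m" "Cod B r = Dom B m"
    "m \<cdot>\<^bsub>B\<^esub> r = Ident B (Dom B m)" "r \<cdot>\<^bsub>B\<^esub> m = Rst B r" "total_map B m"
    using target.restriction_monicE by metis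
  obtain r' where r': "r' \<in> Arr E" "Cod E r' = X" "prone E B p r'" "AMap p r' = r"
    using prone_lift[of X r "Dom B r"] X r md by (auto simp: hom_def)
  have pD: "OMap p (Dom E r') = Cod B m" using r r' AMap_type(2)[of r'] by simp
  \<comment> \<open>The triangle \<open>m r = 1\<close> in the base is precise because
    \<open>m\<close> is total.\<close>
  have "\<exists>!k. k \<in> hom E X (Dom E r') \<and> AMap p k = m \<and> precise_triangle E k r' (Ident E X)"
    by (rule prone_lift_unique[OF r'(3)])
      (use r r' X md pD in \<open>auto simp: hom_def precise_triangle_def AMap_Ident target.total_map_Rst\<close>)
  then obtain n where n: "n \<in> Arr E" "Dom E n = X" "Cod E n = Dom E r'" "AMap p n = m" "n \<cdot>\<^bsub>E\<^esub> r' = Ident E X"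
    by (auto simp: hom_def precise_triangle_def)
  have nt: "total_map E n" using source.section_total[of n r' X] n r' X by auto
  \<comment> \<open>The arrow \<open>r'\<close> is factored through itself over the idempotent
    \<open>r m\<close>. Both the restriction of \<open>r'\<close> and \<open>r' n\<close> solve this
    problem, the latter precisely because \<open>n\<close> is total.\<close>
  have u: "\<exists>!k. k \<in> hom E (Dom E r') (Dom E r') \<and> AMap p k = Rst B r \<and> precise_triangle E k r' r'"
    by (rule prone_lift_unique[OF r'(3)])
      (use r r' pD in \<open>auto simp: hom_def precise_triangle_def target.R1\<close>)
  have "Rst E r' \<in> hom E (Dom E r') (Dom E r') \<and> AMap p (Rst E r') = Rst B r \<and> precise_triangle E (Rst E r') r' r'"
    using r' by (auto simp: hom_def precise_triangle_def AMap_Rst source.R1)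
  moreover have "r' \<cdot>\<^bsub>E\<^esub> n \<in> hom E (Dom E r') (Dom E r') \<and> AMap p (r' \<cdot>\<^bsub>E\<^esub> n) = Rst B r \<and> precise_triangle E (r' \<cdot>\<^bsub>E\<^esub> n) r' r'"
    using r' n nt r by (auto simp: hom_def precise_triangle_def AMap_Comp' source.assoc source.Rst_Comp_total)
  ultimately have "r' \<cdot>\<^bsub>E\<^esub> n = Rst E r'" using u by blast
  then have "restriction_monic E n"
    using n r' by (auto intro!: source.restriction_monicI[of n r'])
  then show "\<exists>n\<in>Mon (Total_mcat E). Dom (Total_mcat E) n = X \<and> AMap p n = m"
    using n by auto
qed

lemma m_fibration_Total_mcat: "m_fibration (Total_mcat E) (Total_mcat B) p"
proof -
  interpret Tp: m_functor "Total_mcat E" "Total_mcat B" p by (rule m_functor_Total_mcat)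
  show ?thesis
  proof
    fix X f A assume X: "X \<in> Obj (Total_mcat E)" and "f \<in> hom (Total_mcat B) A (OMap p X)"
    then show "\<exists>f'\<in>Arr (Total_mcat E). Cod (Total_mcat E) f' = X \<and>
        cartesian (Total_mcat E) (Total_mcat B) p f' \<and> AMap p f' = f"
      using cartesian_Total_mcat[of X f] by (auto simp: hom_def)
  qed (rule m_plentiful_Total_mcat)
qed

end



section \<open>Partial maps as relations on generalized elements\<close>

text \<open>A span \<open>(m, f)\<close> is faithfully represented by the relation between the generalized elements
  \<open>t \<cdot> m\<close> and \<open>t \<cdot> f\<close>. As composition by pullback becomes relational composition, identities about
  \<open>Par\<close> reduce to identities between single-valued relations.\<close>

definition span_rel :: "('o, 'a, 'z) cat_scheme \<Rightarrow> 'a \<Rightarrow> 'a \<Rightarrow> ('a \<times> 'a) set" where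
  "span_rel C m f = {(t \<cdot>\<^bsub>C\<^esub> m, t \<cdot>\<^bsub>C\<^esub> f) | t. t \<in> Arr C \<and> Cod C t = Dom C m}"

definition partial_rel :: "('o, 'a, 'z) mcat_scheme \<Rightarrow> 'o \<Rightarrow> 'o \<Rightarrow> ('a \<times> 'a) set \<Rightarrow> bool" where
  "partial_rel C X Y R \<longleftrightarrow> (\<exists>m f. (m, f) \<in> spans C X Y \<and> R = span_rel C m f)"

text \<open>The spans with a given representable relation form exactly one isomorphism class, so an
  arrow of \<open>Par\<close> is named by its relation without choosing a representative.\<close>

definition par_of :: "('o, 'a, 'z) mcat_scheme \<Rightarrow> 'o \<Rightarrow> 'o \<Rightarrow> ('a \<times> 'a) set \<Rightarrow> ('o, 'a) par_arr" where
  "par_of C X Y R = (X, {(m, f) \<in> spans C X Y. span_rel C m f = R}, Y)"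

context m_category
begin

lemma Mon_Arr [simp]: "m \<in> Mon C \<Longrightarrow> m \<in> Arr C"
  using Mon_monic by (auto simp: monic_def)

lemma Ident_Mon [simp]: "X \<in> Obj C \<Longrightarrow> Ident C X \<in> Mon C"
  by (rule iso_in_Mon) (auto simp: is_iso_def hom_def intro!: exI[of _ "Ident C X"])

lemma Mon_cancel:
  assumes "m \<in> Mon C" "f \<cdot> m = g \<cdot> m" "f \<in> Arr C" "g \<in> Arr C"
    "Dom C f = Dom C g" "Cod C f = Dom C m" "Cod C g = Dom C m"
  shows "f = g"
  using monicD[OF Mon_monic] assms by blast

lemma spansD:
  assumes "(m, f) \<in> spans C X Y"
  shows "m \<in> Mon C" "m \<in> Arr C" "f \<in> Arr C" "Dom C f = Dom C m" "Cod C m = X" "Cod C f = Y"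
    "X \<in> Obj C" "Y \<in> Obj C"
  using assms by (auto simp: spans_def)

lemma spansI:
  "m \<in> Mon C \<Longrightarrow> f \<in> Arr C \<Longrightarrow> Dom C f = Dom C m \<Longrightarrow> Cod C m = X \<Longrightarrow> Cod C f = Y \<Longrightarrow> (m, f) \<in> spans C X Y"
  by (auto simp: spans_def)

lemma span_relI: "t \<in> Arr C \<Longrightarrow> Cod C t = Dom C m \<Longrightarrow> (t \<cdot> m, t \<cdot> f) \<in> span_rel C m f"
  by (auto simp: span_rel_def)

lemma span_relE:
  assumes "(x, y) \<in> span_rel C m f"
  obtains t where "t \<in> Arr C" "Cod C t = Dom C m" "x = t \<cdot> m" "y = t \<cdot> f"
  using assms by (auto simp: span_rel_def)

lemma span_rel_refl:
  assumes "m \<in> Arr C" "f \<in> Arr C" "Dom C f = Dom C m"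
  shows "(m, f) \<in> span_rel C m f"
  using span_relI[of "Ident C (Dom C m)" m f] assms by auto

lemma partial_relI: "(m, f) \<in> spans C X Y \<Longrightarrow> partial_rel C X Y (span_rel C m f)"
  by (auto simp: partial_rel_def)

lemma partial_relE:
  assumes "partial_rel C X Y R"
  obtains m f where "(m, f) \<in> spans C X Y" "R = span_rel C m f"
  using assms by (auto simp: partial_rel_def)

lemma partial_rel_type:
  assumes "partial_rel C X Y R" "(x, y) \<in> R"
  shows "x \<in> Arr C" "y \<in> Arr C" "Cod C x = X" "Cod C y = Y" "Dom C y = Dom C x"
  using assms by (auto simp: partial_rel_def span_rel_def spans_def)

lemma partial_rel_Obj: "partial_rel C X Y R \<Longrightarrow> X \<in> Obj C" "partial_rel C X Y R \<Longrightarrow> Y \<in> Obj C"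
  by (auto simp: partial_rel_def spans_def)

text \<open>The left leg is monic, so \<open>x\<close> factors through it in at most one way, and
  the factorization determines the second component.\<close>

lemma partial_rel_single_valued:
  assumes R: "partial_rel C X Y R" and "(x, y) \<in> R" "(x, z) \<in> R"
  shows "y = z"
proof -
  obtain m f where mf: "(m, f) \<in> spans C X Y" "R = span_rel C m f" by (rule partial_relE[OF R])
  note d = spansD[OF mf(1)]
  obtain s where s: "s \<in> Arr C" "Cod C s = Dom C m" "x = s \<cdot> m" "y = s \<cdot> f"
    using assms(2) mf(2) by (auto elim: span_relE)
  obtain t where t: "t \<in> Arr C" "Cod C t = Dom C m" "x = t \<cdot> m" "z = t \<cdot> f"
    using assms(3) mf(2) by (auto elim: span_relE)
  have "Dom C s = Dom C t" using s t d(2) by (metis Comp_type(2))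
  then have "s = t" using Mon_cancel[OF d(1) _ s(1) t(1) _ s(2) t(2)] s(3) t(3) by metis
  with s t show ?thesis by simp
qed

lemma partial_rel_precompose:
  assumes R: "partial_rel C X Y R" and "(x, y) \<in> R" "s \<in> Arr C" "Cod C s = Dom C x"
  shows "(s \<cdot> x, s \<cdot> y) \<in> R"
proof -
  obtain m f where mf: "(m, f) \<in> spans C X Y" "R = span_rel C m f" by (rule partial_relE[OF R])
  note d = spansD[OF mf(1)]
  obtain t where t: "t \<in> Arr C" "Cod C t = Dom C m" "x = t \<cdot> m" "y = t \<cdot> f"
    using assms(2) mf(2) by (auto elim: span_relE)
  have "((s \<cdot> t) \<cdot> m, (s \<cdot> t) \<cdot> f) \<in> R"
    unfolding mf(2) by (rule span_relI) (use assms t d in auto)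
  then show ?thesis using assms t d by (simp add: assoc)
qed

text \<open>By the domain hypothesis every element of the domain of \<open>R\<close> has the form
  \<open>s a\<close>; closure under precomposition and single-valuedness then force its value to be
  \<open>s y\<close>. This rewrites a relation as that of a span with a prescribed left leg.\<close>

lemma partial_rel_eq_span_rel:
  assumes R: "partial_rel C X Y R" and ay: "(a, y) \<in> R" and D: "Domain R \<subseteq> Domain (span_rel C a b)"
  shows "R = span_rel C a y"
proof
  note ty = partial_rel_type[OF R ay]
  show "span_rel C a y \<subseteq> R"
    using partial_rel_precompose[OF R ay] by (auto elim: span_relE)
  show "R \<subseteq> span_rel C a y"
  proof (rule subrelI)
    fix x z assume xz: "(x, z) \<in> R"
    then obtain s where s: "s \<in> Arr C" "Cod C s = Dom C a" "x = s \<cdot> a"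
      using D by (auto elim!: span_relE)
    then have "z = s \<cdot> y"
      using partial_rel_single_valued[OF R xz] partial_rel_precompose[OF R ay] by blast
    with s show "(x, z) \<in> span_rel C a y" by (auto intro: span_relI)
  qed
qed

text \<open>A Yoneda argument: the legs of a span are related by its own relation, at the identity.
  Finding them in the other relation yields comparison arrows in both directions, which are mutually
  inverse because the left legs are monic.\<close>

lemma span_iso_iff:
  assumes s: "(m, f) \<in> spans C X Y" and t: "(n, g) \<in> spans C X Y"
  shows "span_iso C (m, f) (n, g) \<longleftrightarrow> span_rel C n g = span_rel C m f"
proof
  note d = spansD[OF s] and e = spansD[OF t]
  assume "span_iso C (m, f) (n, g)"
  then obtain i j where i: "i \<in> Arr C" "Dom C i = Dom C m" "Cod C i = Dom C n" "m = i \<cdot> n" "f = i \<cdot> g"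
    and j: "j \<in> Arr C" "Dom C j = Dom C n" "Cod C j = Dom C m" "j \<cdot> i = Ident C (Dom C n)"
    by (auto simp: span_iso_def is_iso_def hom_def)
  have "j \<cdot> m = n" "j \<cdot> f = g" using i j e assoc[of j i n] assoc[of j i g] by auto
  then have "(n, g) \<in> span_rel C m f" using span_relI[of j m f] j by simp
  moreover have "(m, f) \<in> span_rel C n g" using span_relI[of i n g] i by simp
  moreover have "span_rel C a b \<subseteq> span_rel C a' b'"
    if "(a, b) \<in> span_rel C a' b'" "(a', b') \<in> spans C X Y" for a b a' b'
    using partial_rel_precompose[OF partial_relI[OF that(2)] that(1)] by (auto elim!: span_relE[of _ _ a b])
  ultimately show "span_rel C n g = span_rel C m f" using s t by blast
next
  note d = spansD[OF s] and e = spansD[OF t]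
  assume eq: "span_rel C n g = span_rel C m f"
  have "(m, f) \<in> span_rel C n g" using span_rel_refl[of m f] d eq by simp
  then obtain i where i: "i \<in> Arr C" "Cod C i = Dom C n" "m = i \<cdot> n" "f = i \<cdot> g"
    by (rule span_relE)
  have "(n, g) \<in> span_rel C m f" using span_rel_refl[of n g] e eq by simp
  then obtain j where j: "j \<in> Arr C" "Cod C j = Dom C m" "n = j \<cdot> m" "g = j \<cdot> f"
    by (rule span_relE)
  have di: "Dom C i = Dom C m" using i e(2) by (metis Comp_type(2))
  have dj: "Dom C j = Dom C n" using j d(2) by (metis Comp_type(2))
  have "(i \<cdot> j) \<cdot> m = m" using i(1,2) j(1,2) dj d(2) by (simp add: assoc flip: j(3) i(3))
  then have ij: "i \<cdot> j = Ident C (Dom C m)"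
    using i(1,2) j(1,2) di dj d(2) by - (rule Mon_cancel[OF d(1)], simp_all)
  have "(j \<cdot> i) \<cdot> n = n" using i(1,2) j(1,2) di e(2) by (simp add: assoc flip: j(3) i(3))
  then have ji: "j \<cdot> i = Ident C (Dom C n)"
    using i(1,2) j(1,2) di dj e(2) by - (rule Mon_cancel[OF e(1)], simp_all)
  have "is_iso C i" unfolding is_iso_def
    using i(1,2) j(1,2) di dj ij ji by (intro conjI bexI[of _ j]) (simp_all add: hom_def)
  then show "span_iso C (m, f) (n, g)"
    unfolding span_iso_def using i(1,2) di by (intro bexI[of _ i]) (simp_all add: hom_def flip: i(3,4))
qed

lemma span_class_eq:
  assumes "(m, f) \<in> spans C X Y"
  shows "span_class C X Y (m, f) = {(n, g) \<in> spans C X Y. span_rel C n g = span_rel C m f}"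
  using span_iso_iff[OF assms] by (auto simp: span_class_def)

lemma par_of_span:
  "(m, f) \<in> spans C X Y \<Longrightarrow> (X, span_class C X Y (m, f), Y) = par_of C X Y (span_rel C m f)"
  by (simp add: span_class_eq par_of_def)

lemma par_of_inject:
  assumes "partial_rel C X Y R" "par_of C X Y R = par_of C X Y R'"
  shows "R = R'"
  using assms by (auto simp: par_of_def partial_rel_def)

text \<open>A pair in the composite relation comes from generalized elements \<open>a\<close> and
  \<open>b\<close> with \<open>a f = b n\<close>, which by the universal property is one generalized
  element of the pullback.\<close>

lemma span_rel_pullback:
  assumes s: "(m, f) \<in> spans C X Y" and t: "(n, g) \<in> spans C Y Z" and pb: "is_pullback C u v f n"
  shows "(u \<cdot> m, v \<cdot> g) \<in> spans C X Z" "span_rel C (u \<cdot> m) (v \<cdot> g) = span_rel C m f O span_rel C n g"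
proof -
  note d = spansD[OF s] and e = spansD[OF t] and p = is_pullbackD[OF pb]
  have u: "u \<in> Mon C" using Mon_pullback_stable[OF e(1) pb] .
  show "(u \<cdot> m, v \<cdot> g) \<in> spans C X Z"
    by (rule spansI) (use d e p u in \<open>auto intro: Comp_in_Mon\<close>)
  show "span_rel C (u \<cdot> m) (v \<cdot> g) = span_rel C m f O span_rel C n g"
  proof (intro equalityI subrelI)
    fix x z assume "(x, z) \<in> span_rel C (u \<cdot> m) (v \<cdot> g)"
    then obtain w where w: "w \<in> Arr C" "Cod C w = Dom C (u \<cdot> m)" "x = w \<cdot> (u \<cdot> m)" "z = w \<cdot> (v \<cdot> g)"
      by (rule span_relE)
    have cw: "Cod C w = Dom C u" using w p d by simp
    have "(x, (w \<cdot> u) \<cdot> f) \<in> span_rel C m f"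
      using span_relI[of "w \<cdot> u" m f] w(1,3) cw p(1-8) d by (simp add: assoc)
    moreover have "((w \<cdot> v) \<cdot> n, z) \<in> span_rel C n g"
      using span_relI[of "w \<cdot> v" n g] w(1,4) cw p(1-8) e by (simp add: assoc)
    moreover have "(w \<cdot> u) \<cdot> f = (w \<cdot> v) \<cdot> n" using w(1) cw p by (simp add: assoc)
    ultimately show "(x, z) \<in> span_rel C m f O span_rel C n g" by auto
  next
    fix x z assume "(x, z) \<in> span_rel C m f O span_rel C n g"
    then obtain y where xy: "(x, y) \<in> span_rel C m f" and yz: "(y, z) \<in> span_rel C n g" by auto
    obtain a where a: "a \<in> Arr C" "Cod C a = Dom C m" "x = a \<cdot> m" "y = a \<cdot> f" by (rule span_relE[OF xy])
    obtain b where b: "b \<in> Arr C" "Cod C b = Dom C n" "y = b \<cdot> n" "z = b \<cdot> g" by (rule span_relE[OF yz])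
    have "Dom C a = Dom C b" using a b d e by (metis Comp_type(2))
    then obtain w where w: "w \<in> Arr C" "Cod C w = Dom C u" "w \<cdot> u = a" "w \<cdot> v = b"
      using is_pullback_lift[OF pb, of a b] a b d by auto
    have "(w \<cdot> (u \<cdot> m), w \<cdot> (v \<cdot> g)) \<in> span_rel C (u \<cdot> m) (v \<cdot> g)"
      by (rule span_relI) (use w p d in auto)
    then show "(x, z) \<in> span_rel C (u \<cdot> m) (v \<cdot> g)"
      using w p d e a(3) b(4) assoc[of w u m] assoc[of w v g] by auto
  qed
qed

lemma span_pullback_exists:
  assumes "(m, f) \<in> spans C X Y" "(n, g) \<in> spans C Y Z"
  obtains u v where "is_pullback C u v f n"
  using Mon_pullback_exists[of n f] spansD[OF assms(1)] spansD[OF assms(2)] by auto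

lemma partial_rel_relcomp:
  assumes "partial_rel C X Y R" "partial_rel C Y Z Q"
  shows "partial_rel C X Z (R O Q)"
proof -
  obtain m f where s: "(m, f) \<in> spans C X Y" "R = span_rel C m f" by (rule partial_relE[OF assms(1)])
  obtain n g where t: "(n, g) \<in> spans C Y Z" "Q = span_rel C n g" by (rule partial_relE[OF assms(2)])
  obtain u v where "is_pullback C u v f n" by (rule span_pullback_exists[OF s(1) t(1)])
  from span_rel_pullback[OF s(1) t(1) this] show ?thesis
    using s t by (auto simp: partial_rel_def)
qed

text \<open>The family of classes in the union of \<open>Par_Comp\<close> is constant, since the
  relation of the composite span depends only on \<open>R\<close> and \<open>Q\<close>, and
  non-empty, since a pullback exists. Hence the union is that one class.\<close>

lemma Par_Comp_par_of:
  assumes R: "partial_rel C X Y R" and Q: "partial_rel C Y Z Q"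
  shows "par_of C X Y R \<cdot>\<^bsub>Par C\<^esub> par_of C Y Z Q = par_of C X Z (R O Q)"
proof -
  have cls: "span_class C X Z (u \<cdot> m, v \<cdot> g) = {(m, f) \<in> spans C X Z. span_rel C m f = R O Q}"
    if "(m, f) \<in> spans C X Y" "span_rel C m f = R" "(n, g) \<in> spans C Y Z" "span_rel C n g = Q"
      "is_pullback C u v f n" for m f n g u v
    using span_rel_pullback[OF that(1,3,5)] that(2,4) by (simp add: span_class_eq)
  obtain m f where s: "(m, f) \<in> spans C X Y" "R = span_rel C m f" by (rule partial_relE[OF R])
  obtain n g where t: "(n, g) \<in> spans C Y Z" "Q = span_rel C n g" by (rule partial_relE[OF Q])
  obtain u v where pb: "is_pullback C u v f n" by (rule span_pullback_exists[OF s(1) t(1)])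
  have "{span_class C X Z (u \<cdot> m, v \<cdot> g) | m f n g u v.
      (m, f) \<in> {(m, f) \<in> spans C X Y. span_rel C m f = R} \<and>
      (n, g) \<in> {(n, g) \<in> spans C Y Z. span_rel C n g = Q} \<and> is_pullback C u v f n}
    = {{(m, f) \<in> spans C X Z. span_rel C m f = R O Q}}" (is "?L = {?cls}")
  proof (intro equalityI subsetI)
    fix c assume "c \<in> ?L" then show "c \<in> {?cls}" by (auto simp only: mem_Collect_eq prod.case cls singleton_iff)
  next
    fix c assume "c \<in> {?cls}"
    then have "c = span_class C X Z (u \<cdot> m, v \<cdot> g)"
      using cls[OF s(1) s(2)[symmetric] t(1) t(2)[symmetric] pb] by blast
    then show "c \<in> ?L" using s t pb by blast
  qed
  then show ?thesis by (simp add: Par_def Par_Comp_def par_of_def)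
qed

lemma span_rel_Ident: "X \<in> Obj C \<Longrightarrow> span_rel C (Ident C X) (Ident C X) = Id_on {t \<in> Arr C. Cod C t = X}"
  by (force simp: span_rel_def Id_on_def)

lemma partial_rel_Id_on_Obj: "X \<in> Obj C \<Longrightarrow> partial_rel C X X (Id_on {t \<in> Arr C. Cod C t = X})"
  using partial_relI[of "Ident C X" "Ident C X" X X] by (simp add: span_rel_Ident spansI)

lemma Par_Ident: "X \<in> Obj C \<Longrightarrow> Ident (Par C) X = par_of C X X (Id_on {t \<in> Arr C. Cod C t = X})"
  using par_of_span[of "Ident C X" "Ident C X" X X] by (simp add: span_rel_Ident spansI Par_def)

lemma span_rel_diag: "span_rel C m m = Id_on (Domain (span_rel C m f))"
  by (auto simp: span_rel_def Id_on_def)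

lemma span_diag: "(m, f) \<in> spans C X Y \<Longrightarrow> (m, m) \<in> spans C X X"
  by (auto simp: spans_def)

lemma partial_rel_Id_on_Domain: "partial_rel C X Y R \<Longrightarrow> partial_rel C X X (Id_on (Domain R))"
  unfolding partial_rel_def using span_rel_diag span_diag by metis

lemma Par_Rst_par_of:
  assumes R: "partial_rel C X Y R"
  shows "Rst (Par C) (par_of C X Y R) = par_of C X X (Id_on (Domain R))"
proof -
  obtain m f where s: "(m, f) \<in> spans C X Y" "R = span_rel C m f" by (rule partial_relE[OF R])
  have cls: "span_class C X X (n, n) = {(m, f) \<in> spans C X X. span_rel C m f = Id_on (Domain R)}"
    if "(n, g) \<in> spans C X Y" "span_rel C n g = R" for n g
    using span_class_eq[OF span_diag[OF that(1)]] span_rel_diag[of n g] that(2) by simp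
  have "(\<Union>(n, g) \<in> {(m, f) \<in> spans C X Y. span_rel C m f = R}. span_class C X X (n, n))
      = {(m, f) \<in> spans C X X. span_rel C m f = Id_on (Domain R)}" (is "\<Union>?F = ?cls")
  proof -
    have "?F = {?cls}"
    proof (intro equalityI subsetI)
      fix c assume "c \<in> ?F" then show "c \<in> {?cls}" using cls by auto
    next
      fix c assume "c \<in> {?cls}" then show "c \<in> ?F" using s cls[OF s(1) s(2)[symmetric]] by force
    qed
    then show ?thesis by simp
  qed
  then show ?thesis by (simp add: Par_def par_of_def)
qed

section \<open>\<open>Par\<close> as a split restriction category\<close>

lemma Par_simps [simp]:
  "Obj (Par C) = Obj C" "Dom (Par C) (par_of C X Y R) = X" "Cod (Par C) (par_of C X Y R) = Y"
  by (simp_all add: Par_def par_of_def)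

lemma Par_ArrE:
  assumes "a \<in> Arr (Par C)"
  obtains X Y R where "a = par_of C X Y R" "partial_rel C X Y R"
  using assms par_of_span partial_relI by (auto simp: Par_def)

lemma Par_ArrI [simp]: "partial_rel C X Y R \<Longrightarrow> par_of C X Y R \<in> Arr (Par C)"
  using spansD(7,8) by (auto 0 4 simp: Par_def partial_rel_def simp flip: par_of_span)

lemma Par_homI [simp]: "partial_rel C X Y R \<Longrightarrow> par_of C X Y R \<in> hom (Par C) X Y"
  by (simp add: hom_def)

lemma Par_homE:
  assumes "a \<in> hom (Par C) X Y"
  obtains R where "a = par_of C X Y R" "partial_rel C X Y R"
proof -
  have "a \<in> Arr (Par C)" using assms by (simp add: hom_def)
  then obtain X' Y' R where "a = par_of C X' Y' R" "partial_rel C X' Y' R" by (rule Par_ArrE)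
  then show thesis using that assms by (auto simp: hom_def)
qed

lemma category_Par: "category (Par C)"
proof
  fix f assume "f \<in> Arr (Par C)"
  then obtain X Y R where f: "f = par_of C X Y R" "partial_rel C X Y R" by (rule Par_ArrE)
  note o = partial_rel_Obj[OF f(2)]
  show "Dom (Par C) f \<in> Obj (Par C)" "Cod (Par C) f \<in> Obj (Par C)" using f o by simp_all
  have "Id_on {t \<in> Arr C. Cod C t = X} O R = R" "R O Id_on {t \<in> Arr C. Cod C t = Y} = R"
    using partial_rel_type[OF f(2)] by (auto 0 4)
  then show "Ident (Par C) (Dom (Par C) f) \<cdot>\<^bsub>Par C\<^esub> f = f" "f \<cdot>\<^bsub>Par C\<^esub> Ident (Par C) (Cod (Par C) f) = f"
    using f o by (simp_all add: Par_Ident Par_Comp_par_of partial_rel_Id_on_Obj)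
next
  fix f g X Y Z assume f: "f \<in> hom (Par C) X Y" and g: "g \<in> hom (Par C) Y Z"
  show "f \<cdot>\<^bsub>Par C\<^esub> g \<in> hom (Par C) X Z"
    by (rule Par_homE[OF f], rule Par_homE[OF g]) (simp add: Par_Comp_par_of partial_rel_relcomp)
next
  fix f g h W X Y Z assume f: "f \<in> hom (Par C) W X" and g: "g \<in> hom (Par C) X Y" and h: "h \<in> hom (Par C) Y Z"
  show "(f \<cdot>\<^bsub>Par C\<^esub> g) \<cdot>\<^bsub>Par C\<^esub> h = f \<cdot>\<^bsub>Par C\<^esub> (g \<cdot>\<^bsub>Par C\<^esub> h)"
  proof (rule Par_homE[OF f], rule Par_homE[OF g], rule Par_homE[OF h])
    fix R Q P assume "partial_rel C W X R" "partial_rel C X Y Q" "partial_rel C Y Z P"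
      "f = par_of C W X R" "g = par_of C X Y Q" "h = par_of C Y Z P"
    then show ?thesis by (simp add: Par_Comp_par_of partial_rel_relcomp O_assoc)
  qed
qed (simp add: Par_Ident partial_rel_Id_on_Obj)

lemma restriction_category_Par: "restriction_category (Par C)"
proof -
  interpret P: category "Par C" by (rule category_Par)
  show ?thesis
  proof
    fix f X Y assume f: "f \<in> hom (Par C) X Y"
    show "Rst (Par C) f \<in> hom (Par C) X X"
      by (rule Par_homE[OF f]) (simp add: Par_Rst_par_of partial_rel_Id_on_Domain)
  next
    fix f assume "f \<in> Arr (Par C)"
    then obtain X Y R where f: "f = par_of C X Y R" "partial_rel C X Y R" by (rule Par_ArrE)
    have "Id_on (Domain R) O R = R" by auto
    then show "Rst (Par C) f \<cdot>\<^bsub>Par C\<^esub> f = f"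
      using f by (simp add: Par_Rst_par_of Par_Comp_par_of partial_rel_Id_on_Domain)
  next
    fix f g X Y Z assume "f \<in> hom (Par C) X Y" "g \<in> hom (Par C) X Z"
    then obtain R Q where f: "f = par_of C X Y R" "partial_rel C X Y R"
      and g: "g = par_of C X Z Q" "partial_rel C X Z Q" by (metis Par_homE)
    have "Id_on (Domain R) O Id_on (Domain Q) = Id_on (Domain Q) O Id_on (Domain R)"
      "Id_on (Domain (Id_on (Domain R) O Q)) = Id_on (Domain R) O Id_on (Domain Q)" by blast+
    then show "Rst (Par C) f \<cdot>\<^bsub>Par C\<^esub> Rst (Par C) g = Rst (Par C) g \<cdot>\<^bsub>Par C\<^esub> Rst (Par C) f"
      "Rst (Par C) (Rst (Par C) f \<cdot>\<^bsub>Par C\<^esub> g) = Rst (Par C) f \<cdot>\<^bsub>Par C\<^esub> Rst (Par C) g"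
      using f g partial_rel_Id_on_Domain[OF f(2)] partial_rel_Id_on_Domain[OF g(2)]
        partial_rel_relcomp[OF partial_rel_Id_on_Domain[OF f(2)] g(2)]
      by (simp_all add: Par_Rst_par_of Par_Comp_par_of)
  next
    fix f g X Y Z assume "f \<in> hom (Par C) X Y" "g \<in> hom (Par C) Y Z"
    then obtain R Q where f: "f = par_of C X Y R" "partial_rel C X Y R"
      and g: "g = par_of C Y Z Q" "partial_rel C Y Z Q" by (metis Par_homE)
    \<comment> \<open>Among the four axioms this is the one that fails for general relations: some
      values of \<open>x\<close> might lie in the domain of \<open>Q\<close> and others not.\<close>
    have "R O Id_on (Domain Q) = Id_on (Domain (R O Q)) O R"
      using partial_rel_single_valued[OF f(2)] by blast
    then show "f \<cdot>\<^bsub>Par C\<^esub> Rst (Par C) g = Rst (Par C) (f \<cdot>\<^bsub>Par C\<^esub> g) \<cdot>\<^bsub>Par C\<^esub> f"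
      using f g partial_rel_Id_on_Domain[OF g(2)] partial_rel_relcomp[OF f(2) g(2)]
        partial_rel_Id_on_Domain[OF partial_rel_relcomp[OF f(2) g(2)]]
      by (simp add: Par_Rst_par_of Par_Comp_par_of)
  qed
qed

text \<open>The total map given by \<open>m\<close> and its partial inverse split the partial
  identity on the subobject \<open>m\<close>. Monicity of \<open>m\<close> is what makes the
  composite on \<open>Z\<close> an identity.\<close>

lemma Par_splitting:
  assumes m: "m \<in> Mon C" "Dom C m = Z" "Cod C m = X"
  shows "(m, Ident C Z) \<in> spans C X Z" "(Ident C Z, m) \<in> spans C Z X"
    "par_of C X Z (span_rel C m (Ident C Z)) \<cdot>\<^bsub>Par C\<^esub> par_of C Z X (span_rel C (Ident C Z) m)
      = par_of C X X (span_rel C m m)"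
    "par_of C Z X (span_rel C (Ident C Z) m) \<cdot>\<^bsub>Par C\<^esub> par_of C X Z (span_rel C m (Ident C Z))
      = Ident (Par C) Z"
proof -
  have Z: "Z \<in> Obj C" "m \<in> Arr C" using m by auto
  show s: "(m, Ident C Z) \<in> spans C X Z" "(Ident C Z, m) \<in> spans C Z X"
    using m Z by (auto intro!: spansI)
  have a: "span_rel C m (Ident C Z) = {(t \<cdot> m, t) | t. t \<in> Arr C \<and> Cod C t = Z}"
    "span_rel C (Ident C Z) m = {(t, t \<cdot> m) | t. t \<in> Arr C \<and> Cod C t = Z}"
    "span_rel C m m = {(t \<cdot> m, t \<cdot> m) | t. t \<in> Arr C \<and> Cod C t = Z}"
    using m Z unfolding span_rel_def by force+
  have "span_rel C m (Ident C Z) O span_rel C (Ident C Z) m = span_rel C m m"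
    unfolding a by blast
  then show "par_of C X Z (span_rel C m (Ident C Z)) \<cdot>\<^bsub>Par C\<^esub> par_of C Z X (span_rel C (Ident C Z) m)
      = par_of C X X (span_rel C m m)"
    using s by (simp add: Par_Comp_par_of partial_relI)
  have "s = t" if "s \<cdot> m = t \<cdot> m" "s \<in> Arr C" "t \<in> Arr C" "Cod C s = Z" "Cod C t = Z" for s t
    by (rule Mon_cancel[OF m(1)]) (use that m Z Comp_type(2) in \<open>metis+\<close>)
  then have "span_rel C (Ident C Z) m O span_rel C m (Ident C Z) = Id_on {t \<in> Arr C. Cod C t = Z}"
    unfolding a by blast
  then show "par_of C Z X (span_rel C (Ident C Z) m) \<cdot>\<^bsub>Par C\<^esub> par_of C X Z (span_rel C m (Ident C Z))
      = Ident (Par C) Z"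
    using s Z by (simp add: Par_Comp_par_of partial_relI Par_Ident)
qed

lemma Par_restriction_idempotentE:
  assumes "e \<in> Arr (Par C)" "e = Rst (Par C) e"
  obtains X m where "m \<in> Mon C" "Cod C m = X" "e = par_of C X X (span_rel C m m)"
proof -
  obtain X Y R where e: "e = par_of C X Y R" "partial_rel C X Y R" by (rule Par_ArrE[OF assms(1)])
  obtain m f where s: "(m, f) \<in> spans C X Y" "R = span_rel C m f" by (rule partial_relE[OF e(2)])
  have "e = par_of C X X (span_rel C m m)"
    using assms(2) e s by (simp add: Par_Rst_par_of span_rel_diag[of m f])
  with s that show thesis by (auto dest: spansD)
qed

lemma r_split_category_Par: "r_split_category (Par C)"
proof -
  interpret P: restriction_category "Par C" by (rule restriction_category_Par)
  show ?thesis
  proof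
    fix e assume "restriction_idempotent (Par C) e"
    then have "e \<in> Arr (Par C)" "e = Rst (Par C) e" by (auto simp: restriction_idempotent_def hom_def)
    then obtain X m where m: "m \<in> Mon C" "Cod C m = X" "e = par_of C X X (span_rel C m m)"
      by (rule Par_restriction_idempotentE)
    note sp = Par_splitting[OF m(1) refl m(2)]
    have "X \<in> Obj C" "Dom C m \<in> Obj C" using m by auto
    then show "splits (Par C) e"
      unfolding splits_def m(3) using sp(3,4)[symmetric] Par_homI[OF partial_relI[OF sp(1)]]
        Par_homI[OF partial_relI[OF sp(2)]] by (metis Par_simps(1))
  qed
qed

end

text \<open>The pairs \<open>(q x, q y)\<close> alone need not be closed under precomposition with arrows of \<open>S\<close>, hence
  the closure.\<close>

definition map_rel :: "('o2, 'a2, 'z2) cat_scheme \<Rightarrow> ('o1, 'a1, 'o2, 'a2) func \<Rightarrow> ('a1 \<times> 'a1) set \<Rightarrow> ('a2 \<times> 'a2) set"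
where
  "map_rel S q R = (\<Union>(x, y) \<in> R. span_rel S (AMap q x) (AMap q y))"

section \<open>The restriction functor between categories of partial maps\<close>

context m_functor
begin

lemma AMap_spans: "(m, f) \<in> spans T X Y \<Longrightarrow> (AMap q m, AMap q f) \<in> spans S (OMap q X) (OMap q Y)"
  by (auto simp: spans_def AMap_in_Mon)

text \<open>The pair of legs generates the whole relation under precomposition, and a functor
  respects this, so the image is generated by the images of the legs.\<close>

lemma map_rel_span_rel:
  assumes "(m, f) \<in> spans T X Y"
  shows "map_rel S q (span_rel T m f) = span_rel S (AMap q m) (AMap q f)"
proof
  note d = source.spansD[OF assms]
  note P = target.partial_relI[OF AMap_spans[OF assms]]
  show "span_rel S (AMap q m) (AMap q f) \<subseteq> map_rel S q (span_rel T m f)"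
    unfolding map_rel_def using source.span_rel_refl[of m f] d by force
  show "map_rel S q (span_rel T m f) \<subseteq> span_rel S (AMap q m) (AMap q f)"
  proof (rule subrelI)
    fix a b assume "(a, b) \<in> map_rel S q (span_rel T m f)"
    then obtain x y where "(x, y) \<in> span_rel T m f" and ab: "(a, b) \<in> span_rel S (AMap q x) (AMap q y)"
      by (auto simp: map_rel_def)
    then obtain t where t: "t \<in> Arr T" "Cod T t = Dom T m" "x = t \<cdot>\<^bsub>T\<^esub> m" "y = t \<cdot>\<^bsub>T\<^esub> f"
      by (blast elim: source.span_relE)
    have xy: "(AMap q x, AMap q y) \<in> span_rel S (AMap q m) (AMap q f)"
      using target.span_relI[of "AMap q t" "AMap q m" "AMap q f"] t d by (simp add: AMap_Comp')
    show "(a, b) \<in> span_rel S (AMap q m) (AMap q f)"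
      using target.partial_rel_precompose[OF P xy] ab by (blast elim: target.span_relE)
  qed
qed

lemma partial_rel_map_rel:
  assumes "partial_rel T X Y R" shows "partial_rel S (OMap q X) (OMap q Y) (map_rel S q R)"
  unfolding partial_rel_def using assms AMap_spans map_rel_span_rel by (blast elim: source.partial_relE)

lemma AMap_mem_map_rel: "partial_rel T X Y R \<Longrightarrow> (x, y) \<in> R \<Longrightarrow> (AMap q x, AMap q y) \<in> map_rel S q R"
  using source.partial_rel_type[of X Y R x y] target.span_rel_refl[of "AMap q x" "AMap q y"]
  by (auto simp: map_rel_def)

text \<open>Preservation of pullbacks enters here. Functoriality by itself gives the inclusion from
  left to right; for the converse the image of the pullback must again be a pullback.\<close>

lemma map_rel_relcomp:
  assumes R: "partial_rel T X Y R" and Q: "partial_rel T Y Z Q"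
  shows "map_rel S q (R O Q) = map_rel S q R O map_rel S q Q"
proof -
  obtain m f where s: "(m, f) \<in> spans T X Y" "R = span_rel T m f" by (rule source.partial_relE[OF R])
  obtain n g where t: "(n, g) \<in> spans T Y Z" "Q = span_rel T n g" by (rule source.partial_relE[OF Q])
  note d = source.spansD[OF s(1)] and e = source.spansD[OF t(1)]
  obtain u v where pb: "is_pullback T u v f n" by (rule source.span_pullback_exists[OF s(1) t(1)])
  note sp = source.span_rel_pullback[OF s(1) t(1) pb] and p = source.is_pullbackD[OF pb]
  note sq = target.span_rel_pullback[OF AMap_spans[OF s(1)] AMap_spans[OF t(1)] AMap_pullback[OF e(1) pb]]
  have "map_rel S q (R O Q) = span_rel S (AMap q (u \<cdot>\<^bsub>T\<^esub> m)) (AMap q (v \<cdot>\<^bsub>T\<^esub> g))"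
    using map_rel_span_rel[OF sp(1)] sp(2) s(2) t(2) by simp
  also have "\<dots> = span_rel S (AMap q u \<cdot>\<^bsub>S\<^esub> AMap q m) (AMap q v \<cdot>\<^bsub>S\<^esub> AMap q g)"
    using p(1-8) d e by (simp add: AMap_Comp')
  also have "\<dots> = map_rel S q R O map_rel S q Q"
    using sq(2) s t by (simp add: map_rel_span_rel)
  finally show ?thesis .
qed

lemma map_rel_Id_on_Domain:
  assumes R: "partial_rel T X Y R"
  shows "map_rel S q (Id_on (Domain R)) = Id_on (Domain (map_rel S q R))"
proof -
  obtain m f where s: "(m, f) \<in> spans T X Y" "R = span_rel T m f" by (rule source.partial_relE[OF R])
  have "map_rel S q (Id_on (Domain R)) = span_rel S (AMap q m) (AMap q m)"
    using map_rel_span_rel[OF source.span_diag[OF s(1)]] source.span_rel_diag[of m f] s(2) by simp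
  also have "\<dots> = Id_on (Domain (map_rel S q R))"
    using target.span_rel_diag[of "AMap q m" "AMap q f"] map_rel_span_rel[OF s(1)] s(2) by simp
  finally show ?thesis .
qed

lemma Par_map_simps [simp]: "OMap (Par_map S q) = OMap q"
  by (simp add: Par_map_def)

lemma Par_map_par_of:
  assumes R: "partial_rel T X Y R"
  shows "AMap (Par_map S q) (par_of T X Y R) = par_of S (OMap q X) (OMap q Y) (map_rel S q R)"
proof -
  have cls: "span_class S (OMap q X) (OMap q Y) (AMap q m, AMap q f)
      = {(n, g) \<in> spans S (OMap q X) (OMap q Y). span_rel S n g = map_rel S q R}"
    if "(m, f) \<in> spans T X Y" "span_rel T m f = R" for m f
    using target.span_class_eq[OF AMap_spans[OF that(1)]] map_rel_span_rel[OF that(1)] that(2) by simp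
  obtain m f where s: "(m, f) \<in> spans T X Y" "R = span_rel T m f" by (rule source.partial_relE[OF R])
  have "(\<lambda>(m, f). span_class S (OMap q X) (OMap q Y) (AMap q m, AMap q f)) ` {(m, f) \<in> spans T X Y. span_rel T m f = R}
      = {{(n, g) \<in> spans S (OMap q X) (OMap q Y). span_rel S n g = map_rel S q R}}" (is "?F = {?cls}")
  proof (intro equalityI subsetI)
    fix c assume "c \<in> ?F" then show "c \<in> {?cls}" using cls by auto
  next
    fix c assume "c \<in> {?cls}" then show "c \<in> ?F" using s cls[OF s(1) s(2)[symmetric]] by force
  qed
  then show ?thesis by (simp add: Par_map_def par_of_def)
qed

lemma restriction_functor_Par: "restriction_functor (Par T) (Par S) (Par_map S q)"
proof -
  interpret PT: restriction_category "Par T" by (rule source.restriction_category_Par)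
  interpret PS: restriction_category "Par S" by (rule target.restriction_category_Par)
  show ?thesis
  proof
    fix X assume "X \<in> Obj (Par T)"
    then have X: "X \<in> Obj T" by simp
    then show "OMap (Par_map S q) X \<in> Obj (Par S)" by simp
    have "(Ident T X, Ident T X) \<in> spans T X X" using X by (simp add: source.spansI)
    from map_rel_span_rel[OF this]
    show "AMap (Par_map S q) (Ident (Par T) X) = Ident (Par S) (OMap (Par_map S q) X)"
      using X source.partial_rel_Id_on_Obj[OF X]
      by (simp add: source.Par_Ident target.Par_Ident Par_map_par_of source.span_rel_Ident target.span_rel_Ident AMap_Ident)
  next
    fix f X Y assume f: "f \<in> hom (Par T) X Y"
    show "AMap (Par_map S q) f \<in> hom (Par S) (OMap (Par_map S q) X) (OMap (Par_map S q) Y)"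
      by (rule source.Par_homE[OF f]) (simp add: Par_map_par_of partial_rel_map_rel)
  next
    fix f g X Y Z assume "f \<in> hom (Par T) X Y" "g \<in> hom (Par T) Y Z"
    then obtain R Q where f: "f = par_of T X Y R" "partial_rel T X Y R"
      and g: "g = par_of T Y Z Q" "partial_rel T Y Z Q" by (metis source.Par_homE)
    show "AMap (Par_map S q) (f \<cdot>\<^bsub>Par T\<^esub> g) = AMap (Par_map S q) f \<cdot>\<^bsub>Par S\<^esub> AMap (Par_map S q) g"
      unfolding f(1) g(1) using f(2) g(2) source.partial_rel_relcomp[OF f(2) g(2)]
        partial_rel_map_rel[OF f(2)] partial_rel_map_rel[OF g(2)] map_rel_relcomp[OF f(2) g(2)]
      by (simp add: Par_map_par_of source.Par_Comp_par_of target.Par_Comp_par_of)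
  next
    fix f assume "f \<in> Arr (Par T)"
    then obtain X Y R where f: "f = par_of T X Y R" "partial_rel T X Y R" by (rule source.Par_ArrE)
    show "AMap (Par_map S q) (Rst (Par T) f) = Rst (Par S) (AMap (Par_map S q) f)"
      unfolding f(1) using f(2) source.partial_rel_Id_on_Domain[OF f(2)] partial_rel_map_rel[OF f(2)]
      by (simp add: Par_map_par_of source.Par_Rst_par_of target.Par_Rst_par_of map_rel_Id_on_Domain)
  qed
qed

lemma Par_map_span:
  assumes "(m, f) \<in> spans T X Y"
  shows "AMap (Par_map S q) (par_of T X Y (span_rel T m f))
    = par_of S (OMap q X) (OMap q Y) (span_rel S (AMap q m) (AMap q f))"
  using Par_map_par_of[OF source.partial_relI[OF assms]] map_rel_span_rel[OF assms] by simp

end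

section \<open>From M-fibrations to latent fibrations\<close>

lemma cartesian_ex1:
  assumes "cartesian T S q f'" "g \<in> hom T Y (Cod T f')" "h \<in> hom S (OMap q Y) (OMap q (Dom T f'))"
    "h \<cdot>\<^bsub>S\<^esub> AMap q f' = AMap q g"
  shows "\<exists>!k. k \<in> hom T Y (Dom T f') \<and> AMap q k = h \<and> k \<cdot>\<^bsub>T\<^esub> f' = g"
proof -
  have "\<forall>Y. \<forall>g \<in> hom T Y (Cod T f'). \<forall>h \<in> hom S (OMap q Y) (OMap q (Dom T f')).
        h \<cdot>\<^bsub>S\<^esub> AMap q f' = AMap q g \<longrightarrow>
        (\<exists>!k. k \<in> hom T Y (Dom T f') \<and> AMap q k = h \<and> k \<cdot>\<^bsub>T\<^esub> f' = g)"
    using assms(1) unfolding cartesian_def by (rule conjunct2)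
  from this[rule_format, OF assms(2-4)] show ?thesis .
qed

context m_fibration
begin

text \<open>The inverse is the factorization \<open>k\<close> of the identity through
  \<open>f'\<close> over \<open>h\<close>. That \<open>f' k\<close> is an identity follows because
  both factor \<open>f'\<close> through itself over an identity.\<close>

lemma cartesian_over_iso:
  assumes f': "cartesian T S q f'" and h: "h \<in> Arr S" "Dom S h = OMap q (Cod T f')" "Cod S h = OMap q (Dom T f')"
    and inv: "h \<cdot>\<^bsub>S\<^esub> AMap q f' = Ident S (OMap q (Cod T f'))" "AMap q f' \<cdot>\<^bsub>S\<^esub> h = Ident S (OMap q (Dom T f'))"
  shows "is_iso T f'"
proof -
  have fA: "f' \<in> Arr T" using f' by (simp add: cartesian_def)
  let ?X = "Cod T f'" and ?X' = "Dom T f'"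
  have "\<exists>!k. k \<in> hom T ?X ?X' \<and> AMap q k = h \<and> k \<cdot>\<^bsub>T\<^esub> f' = Ident T ?X"
    by (rule cartesian_ex1[OF f']) (use fA h inv in \<open>simp_all add: hom_def AMap_Ident\<close>)
  then obtain k where k: "k \<in> Arr T" "Dom T k = ?X" "Cod T k = ?X'" "AMap q k = h" "k \<cdot>\<^bsub>T\<^esub> f' = Ident T ?X"
    unfolding hom_def by blast
  have u: "\<exists>!l. l \<in> hom T ?X' ?X' \<and> AMap q l = Ident S (OMap q ?X') \<and> l \<cdot>\<^bsub>T\<^esub> f' = f'"
    by (rule cartesian_ex1[OF f']) (use fA in \<open>simp_all add: hom_def\<close>)
  have "f' \<cdot>\<^bsub>T\<^esub> k \<in> hom T ?X' ?X' \<and> AMap q (f' \<cdot>\<^bsub>T\<^esub> k) = Ident S (OMap q ?X') \<and> (f' \<cdot>\<^bsub>T\<^esub> k) \<cdot>\<^bsub>T\<^esub> f' = f'"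
    using k fA inv by (simp add: hom_def AMap_Comp' source.assoc)
  moreover have "Ident T ?X' \<in> hom T ?X' ?X' \<and> AMap q (Ident T ?X') = Ident S (OMap q ?X') \<and> Ident T ?X' \<cdot>\<^bsub>T\<^esub> f' = f'"
    using fA by (simp add: hom_def AMap_Ident)
  ultimately have "f' \<cdot>\<^bsub>T\<^esub> k = Ident T ?X'" using u by blast
  then show ?thesis
    unfolding is_iso_def using fA k by (intro conjI bexI[of _ k]) (simp_all add: hom_def)
qed

text \<open>A monic over an isomorphism can be moved into the fibre by reindexing its domain along the
  inverse of that isomorphism.\<close>

lemma Mon_move_to_fibre:
  assumes m: "m \<in> Mon T" and t: "t \<in> Arr S" "Cod S t = OMap q (Dom T m)" "t \<cdot>\<^bsub>S\<^esub> AMap q m = Ident S (OMap q (Cod T m))"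
  obtains n where "n \<in> Mon T" "Cod T n = Cod T m" "OMap q (Dom T n) = OMap q (Cod T m)"
    "AMap q n = Ident S (OMap q (Cod T m))" "span_rel T n n = span_rel T m m"
proof -
  let ?A = "OMap q (Cod T m)"
  have mA: "m \<in> Arr T" using m by simp
  have A: "?A \<in> Obj S" using mA by simp
  have td: "Dom S t = ?A"
    using t mA A target.Comp_type(2)[of t "AMap q m"] target.Ident_type(2)[OF A] by simp
  \<comment> \<open>The arrow \<open>t\<close> is a one-sided inverse of the monic
    \<open>q m\<close>; cancelling that monic makes it two-sided.\<close>
  have "(AMap q m \<cdot>\<^bsub>S\<^esub> t) \<cdot>\<^bsub>S\<^esub> AMap q m = Ident S (OMap q (Dom T m)) \<cdot>\<^bsub>S\<^esub> AMap q m"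
    using t td mA by (simp add: target.assoc)
  then have mt: "AMap q m \<cdot>\<^bsub>S\<^esub> t = Ident S (OMap q (Dom T m))"
    using t td mA by - (rule target.Mon_cancel[OF AMap_in_Mon[OF m]], simp_all)
  obtain f' where f': "f' \<in> Arr T" "Cod T f' = Dom T m" "cartesian T S q f'" "AMap q f' = t"
    using cartesian_lift[of "Dom T m" t "Dom S t"] t mA by (auto simp: hom_def)
  have D: "OMap q (Dom T f') = ?A" using AMap_type(2)[OF f'(1)] f'(4) td by simp
  have iso: "is_iso T f'"
    by (rule cartesian_over_iso[OF f'(3), of "AMap q m"]) (use f' mA D mt t in simp_all)
  then have nM: "f' \<cdot>\<^bsub>T\<^esub> m \<in> Mon T"
    using source.Comp_in_Mon[OF source.iso_in_Mon m] f' by simp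
  have "span_iso T (f' \<cdot>\<^bsub>T\<^esub> m, f' \<cdot>\<^bsub>T\<^esub> m) (m, m)"
    unfolding span_iso_def using iso f' mA by (intro bexI[of _ f']) (simp_all add: hom_def)
  moreover have "(f' \<cdot>\<^bsub>T\<^esub> m, f' \<cdot>\<^bsub>T\<^esub> m) \<in> spans T (Cod T m) (Cod T m)" "(m, m) \<in> spans T (Cod T m) (Cod T m)"
    using nM m f' by (auto intro!: source.spansI)
  ultimately have "span_rel T (f' \<cdot>\<^bsub>T\<^esub> m) (f' \<cdot>\<^bsub>T\<^esub> m) = span_rel T m m"
    using source.span_iso_iff by metis
  then show thesis
    using that[OF nM] f' mA D t by (simp add: AMap_Comp')
qed

lemma well_fibred_Par: "well_fibred (Par T) (Par S) (Par_map S q)"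
  unfolding well_fibred_def
proof (intro ballI allI impI, elim conjE)
  fix A e assume ri: "restriction_idempotent (fibre (Par T) (Par S) (Par_map S q) A) e"
  have e: "e \<in> Arr (Par T)" "e = Rst (Par T) e" "AMap (Par_map S q) e = Ident (Par S) A"
    "OMap q (Dom (Par T) e) = A"
    using ri by (auto simp: restriction_idempotent_def fibre_def hom_def)
  obtain X m where m: "m \<in> Mon T" "Cod T m = X" "e = par_of T X X (span_rel T m m)"
    by (rule source.Par_restriction_idempotentE[OF e(1,2)])
  have X: "X \<in> Obj T" "OMap q X = A" using m e(4) by auto
  then have A: "A \<in> Obj S" by auto
  have mm: "(m, m) \<in> spans T X X" using m by (auto intro!: source.spansI)
  have "par_of S A A (span_rel S (AMap q m) (AMap q m)) = par_of S A A (Id_on {t \<in> Arr S. Cod S t = A})"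
    using e(3) Par_map_span[OF mm] X A m(3) by (simp add: target.Par_Ident)
  then have "span_rel S (AMap q m) (AMap q m) = Id_on {t \<in> Arr S. Cod S t = A}"
    using target.par_of_inject[OF target.partial_relI[OF AMap_spans[OF mm]]] X by simp
  \<comment> \<open>Evaluating the relation at the identity of \<open>A\<close> produces the inverse
    \<open>t\<close> of \<open>q m\<close>.\<close>
  then have "(Ident S A, Ident S A) \<in> span_rel S (AMap q m) (AMap q m)" using A by auto
  then obtain t where t: "t \<in> Arr S" "Cod S t = Dom S (AMap q m)" "Ident S A = t \<cdot>\<^bsub>S\<^esub> AMap q m"
    by (rule target.span_relE)
  obtain n where n: "n \<in> Mon T" "Cod T n = X" "OMap q (Dom T n) = A" "AMap q n = Ident S A"
    "span_rel T n n = span_rel T m m"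
    using Mon_move_to_fibre[OF m(1), of t] t m X by auto
  define Z where "Z = Dom T n"
  have Z: "Z \<in> Obj T" "OMap q Z = A" using n by (auto simp: Z_def)
  note sp = source.Par_splitting[OF n(1) Z_def[symmetric] n(2)]
  note sp1 = source.partial_relI[OF sp(1)] and sp2 = source.partial_relI[OF sp(2)]
  have Ai: "par_of S A A (span_rel S (Ident S A) (Ident S A)) = Ident (Par S) A"
    using A by (simp add: target.Par_Ident target.span_rel_Ident)
  have "AMap (Par_map S q) (par_of T X Z (span_rel T n (Ident T Z))) = Ident (Par S) A"
    "AMap (Par_map S q) (par_of T Z X (span_rel T (Ident T Z) n)) = Ident (Par S) A"
    using Par_map_span[OF sp(1)] Par_map_span[OF sp(2)] X Z n by (simp_all add: AMap_Ident Ai)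
  then show "splits (fibre (Par T) (Par S) (Par_map S q) A) e"
    unfolding splits_def fibre_def hom_def
    using sp(3,4) n(5) m(3) X Z sp1 sp2
    by (intro bexI[of _ X] bexI[of _ Z] bexI[of _ "par_of T X Z (span_rel T n (Ident T Z))"]
        bexI[of _ "par_of T Z X (span_rel T (Ident T Z) n)"]) simp_all
qed

lemma prone_Par:
  assumes n: "n \<in> Mon T" and g': "cartesian T S q g'" "Dom T g' = Dom T n"
  shows "prone (Par T) (Par S) (Par_map S q) (par_of T (Cod T n) (Cod T g') (span_rel T n g'))"
proof -
  have g'A: "g' \<in> Arr T" using g'(1) by (simp add: cartesian_def)
  have nA: "n \<in> Arr T" using n by simp
  let ?m = "AMap q n" and ?g = "AMap q g'" and ?N = "Cod T n" and ?X = "Cod T g'"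
  have sf: "(n, g') \<in> spans T ?N ?X" using n g'A g'(2) by (auto intro!: source.spansI)
  note pf = source.partial_relI[OF sf] and qf = target.partial_relI[OF AMap_spans[OF sf]]
  let ?f = "par_of T ?N ?X (span_rel T n g')"
  have main: "\<exists>!K. K \<in> hom (Par T) Y ?N \<and> AMap (Par_map S q) K = H \<and> precise_triangle (Par T) K ?f G"
    if G: "G \<in> hom (Par T) Y ?X" and H: "H \<in> hom (Par S) (OMap q Y) (OMap q ?N)"
      and pr: "precise_triangle (Par S) H (AMap (Par_map S q) ?f) (AMap (Par_map S q) G)" for Y G H
  proof -
    obtain RG where RG: "G = par_of T Y ?X RG" "partial_rel T Y ?X RG" by (rule source.Par_homE[OF G])
    obtain a b where ab: "(a, b) \<in> spans T Y ?X" "RG = span_rel T a b" by (rule source.partial_relE[OF RG(2)])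
    note d = source.spansD[OF ab(1)]
    obtain RH where RH: "H = par_of S (OMap q Y) (OMap q ?N) RH" "partial_rel S (OMap q Y) (OMap q ?N) RH"
      by (rule target.Par_homE[OF H])
    let ?qG = "span_rel S (AMap q a) (AMap q b)"
    have pq: "partial_rel S (OMap q Y) (OMap q ?X) ?qG" by (rule target.partial_relI[OF AMap_spans[OF ab(1)]])
    have "par_of S (OMap q Y) (OMap q ?X) (RH O span_rel S ?m ?g) = par_of S (OMap q Y) (OMap q ?X) ?qG"
      "par_of S (OMap q Y) (OMap q Y) (Id_on (Domain ?qG)) = par_of S (OMap q Y) (OMap q Y) (Id_on (Domain RH))"
      using pr RH RG ab Par_map_span[OF sf] Par_map_span[OF ab(1)] qf pq
      by (simp_all add: precise_triangle_def target.Par_Comp_par_of target.Par_Rst_par_of)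
    then have comp: "RH O span_rel S ?m ?g = ?qG" and "Id_on (Domain ?qG) = Id_on (Domain RH)"
      using target.par_of_inject[OF pq] target.par_of_inject[OF target.partial_rel_Id_on_Domain[OF pq]] by metis+
    then have dom: "Domain RH = Domain ?qG" by (metis Domain_Id_on)
    have "(AMap q a, AMap q b) \<in> RH O span_rel S ?m ?g"
      unfolding comp using target.span_rel_refl d by simp
    then obtain w where w: "(AMap q a, w) \<in> RH" "(w, AMap q b) \<in> span_rel S ?m ?g" by auto
    obtain t where t: "t \<in> Arr S" "Cod S t = Dom S ?m" "w = t \<cdot>\<^bsub>S\<^esub> ?m" "AMap q b = t \<cdot>\<^bsub>S\<^esub> ?g"
      by (rule target.span_relE[OF w(2)])
    have td: "Dom S t = OMap q (Dom T a)"
      using target.partial_rel_type(5)[OF RH(2) w(1)] t nA d by simp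
    \<comment> \<open>Precision gives \<open>H\<close> the domain of definition of the image of
      \<open>G\<close>, so \<open>H\<close> is represented by a span with left leg
      \<open>q a\<close>. Its right leg factors through \<open>q n\<close> by
      \<open>t\<close>.\<close>
    have RHe: "RH = span_rel S (AMap q a) (t \<cdot>\<^bsub>S\<^esub> ?m)"
      using target.partial_rel_eq_span_rel[OF RH(2) w(1)] dom t(3) by blast
    \<comment> \<open>What remains is to lift \<open>t\<close> along the total map
      \<open>g'\<close>; the lift \<open>k\<close> gives the span \<open>(a, k n)\<close> as the
      required arrow.\<close>
    have exk: "\<exists>!k. k \<in> hom T (Dom T a) (Dom T g') \<and> AMap q k = t \<and> k \<cdot>\<^bsub>T\<^esub> g' = b"
      by (rule cartesian_ex1[OF g'(1)]) (use d t(1,2,4) td nA g' in \<open>simp_all add: hom_def\<close>)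
    obtain k where kp: "k \<in> hom T (Dom T a) (Dom T g') \<and> AMap q k = t \<and> k \<cdot>\<^bsub>T\<^esub> g' = b"
      by (rule ex1E[OF exk])
    have k: "k \<in> Arr T" "Dom T k = Dom T a" "Cod T k = Dom T n" "AMap q k = t" "k \<cdot>\<^bsub>T\<^esub> g' = b"
      using kp g'(2) by (simp_all add: hom_def)
    have sK: "(a, k \<cdot>\<^bsub>T\<^esub> n) \<in> spans T Y ?N" using d k nA by (auto intro!: source.spansI)
    note pK = source.partial_relI[OF sK]
    let ?K = "par_of T Y ?N (span_rel T a (k \<cdot>\<^bsub>T\<^esub> n))"
    have dom_eq: "Domain (span_rel T a c) = Domain (span_rel T a c')" for c c'
      by (auto simp: span_rel_def)
    have "(a, b) \<in> span_rel T a (k \<cdot>\<^bsub>T\<^esub> n) O span_rel T n g'"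
      using source.span_rel_refl[of a "k \<cdot>\<^bsub>T\<^esub> n"] source.span_relI[of k n g'] d k nA by auto
    moreover have "Domain (span_rel T a (k \<cdot>\<^bsub>T\<^esub> n) O span_rel T n g') \<subseteq> Domain (span_rel T a b)"
      using dom_eq[of "k \<cdot>\<^bsub>T\<^esub> n" b] by blast
    ultimately have Kc: "span_rel T a (k \<cdot>\<^bsub>T\<^esub> n) O span_rel T n g' = span_rel T a b"
      by (rule source.partial_rel_eq_span_rel[OF source.partial_rel_relcomp[OF pK pf]])
    show ?thesis
    proof (rule ex1I[of _ ?K], intro conjI)
      show "?K \<in> hom (Par T) Y ?N" using pK by simp
      show "AMap (Par_map S q) ?K = H"
        using Par_map_span[OF sK] RH(1) RHe k nA by (simp add: AMap_Comp')
      show "precise_triangle (Par T) ?K ?f G"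
        using pK pf RG ab(2) Kc dom_eq[of b "k \<cdot>\<^bsub>T\<^esub> n"]
        by (simp add: precise_triangle_def source.Par_Comp_par_of source.Par_Rst_par_of)
    next
      fix L assume L: "L \<in> hom (Par T) Y ?N \<and> AMap (Par_map S q) L = H \<and> precise_triangle (Par T) L ?f G"
      then have Lh: "L \<in> hom (Par T) Y ?N" by blast
      obtain R where R: "L = par_of T Y ?N R" "partial_rel T Y ?N R" by (rule source.Par_homE[OF Lh])
      have "par_of T Y ?X (R O span_rel T n g') = par_of T Y ?X RG"
        "par_of T Y Y (Id_on (Domain RG)) = par_of T Y Y (Id_on (Domain R))"
        using L R RG pf by (simp_all add: precise_triangle_def source.Par_Comp_par_of source.Par_Rst_par_of)
      then have Rc: "R O span_rel T n g' = span_rel T a b" and "Id_on (Domain RG) = Id_on (Domain R)"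
        using source.par_of_inject[OF RG(2)] source.par_of_inject[OF source.partial_rel_Id_on_Domain[OF RG(2)]] ab(2)
        by metis+
      then have Rd: "Domain R = Domain (span_rel T a b)" using ab(2) by (metis Domain_Id_on)
      have "par_of S (OMap q Y) (OMap q ?N) RH = par_of S (OMap q Y) (OMap q ?N) (map_rel S q R)"
        using L R RH(1) by (simp add: Par_map_par_of)
      then have Rq: "map_rel S q R = RH" using target.par_of_inject[OF RH(2)] by simp
      \<comment> \<open>A competing \<open>L\<close> has the same domain of definition as
        \<open>G\<close>, hence is represented by \<open>(a, l n)\<close>. Cancelling the monic
        \<open>q n\<close> shows that \<open>l\<close> solves the same cartesian lifting problem as
        \<open>k\<close>.\<close>
      have "(a, b) \<in> R O span_rel T n g'" unfolding Rc using source.span_rel_refl d by simp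
      then obtain w' where w': "(a, w') \<in> R" "(w', b) \<in> span_rel T n g'" by auto
      obtain l where l: "l \<in> Arr T" "Cod T l = Dom T n" "w' = l \<cdot>\<^bsub>T\<^esub> n" "b = l \<cdot>\<^bsub>T\<^esub> g'"
        by (rule source.span_relE[OF w'(2)])
      have ld: "Dom T l = Dom T a"
        using source.partial_rel_type(5)[OF R(2) w'(1)] l nA by simp
      have "(AMap q a, AMap q w') \<in> RH" using AMap_mem_map_rel[OF R(2) w'(1)] Rq by simp
      then have "AMap q w' = t \<cdot>\<^bsub>S\<^esub> ?m"
        using target.partial_rel_single_valued[OF RH(2) _ w(1)] t(3) by blast
      then have "AMap q l \<cdot>\<^bsub>S\<^esub> ?m = t \<cdot>\<^bsub>S\<^esub> ?m" using l nA by (simp add: AMap_Comp')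
      then have "AMap q l = t"
        using l(1,2) ld t(1,2) td nA by - (rule target.Mon_cancel[OF AMap_in_Mon[OF n]], simp_all)
      then have "l \<in> hom T (Dom T a) (Dom T g') \<and> AMap q l = t \<and> l \<cdot>\<^bsub>T\<^esub> g' = b"
        using l ld g'(2) by (simp add: hom_def)
      then have "l = k" using exk kp by blast
      then have "R = span_rel T a (k \<cdot>\<^bsub>T\<^esub> n)"
        using source.partial_rel_eq_span_rel[OF R(2) w'(1)] Rd l(3) by blast
      then show "L = ?K" using R(1) by simp
    qed
  qed
  show ?thesis
    unfolding prone_def using pf main by simp
qed

lemma r_split_latent_fibration_Par: "r_split_latent_fibration (Par T) (Par S) (Par_map S q)"
proof -
  interpret PT: r_split_category "Par T" by (rule source.r_split_category_Par)
  interpret PS: r_split_category "Par S" by (rule target.r_split_category_Par)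
  interpret Pq: restriction_functor "Par T" "Par S" "Par_map S q" by (rule restriction_functor_Par)
  show ?thesis
  proof
    fix X f A assume X: "X \<in> Obj (Par T)" and "f \<in> hom (Par S) A (OMap (Par_map S q) X)"
    then have "f \<in> hom (Par S) A (OMap q X)" by simp
    then obtain R where f: "f = par_of S A (OMap q X) R" "partial_rel S A (OMap q X) R"
      by (rule target.Par_homE)
    obtain m g where mg: "(m, g) \<in> spans S A (OMap q X)" "R = span_rel S m g"
      by (rule target.partial_relE[OF f(2)])
    note d = target.spansD[OF mg(1)]
    obtain g' where g': "g' \<in> Arr T" "Cod T g' = X" "cartesian T S q g'" "AMap q g' = g"
      using cartesian_lift[of X g "Dom S g"] X d by (auto simp: hom_def)
    have "OMap q (Dom T g') = Dom S m" using AMap_type(2)[OF g'(1)] g'(4) d(4) by simp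
    then obtain n where n: "n \<in> Mon T" "Dom T n = Dom T g'" "AMap q n = m"
      using m_plentiful g'(1) d(1) unfolding m_plentiful_def by force
    have N: "OMap q (Cod T n) = A" using AMap_type(3)[of n] n d by simp
    have sf: "(n, g') \<in> spans T (Cod T n) X" using n g' by (auto intro!: source.spansI)
    have "prone (Par T) (Par S) (Par_map S q) (par_of T (Cod T n) X (span_rel T n g'))"
      using prone_Par[OF n(1) g'(3)] n g' by simp
    moreover have "AMap (Par_map S q) (par_of T (Cod T n) X (span_rel T n g')) = f"
      using Par_map_span[OF sf] f mg N n g' by simp
    ultimately show "\<exists>f'\<in>Arr (Par T). Cod (Par T) f' = X \<and> prone (Par T) (Par S) (Par_map S q) f' \<and>
        AMap (Par_map S q) f' = f"
      using source.partial_relI[OF sf]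
      by (intro bexI[of _ "par_of T (Cod T n) X (span_rel T n g')"]) simp_all
  qed (rule well_fibred_Par)
qed

end

theorem theorem5p9:
  fixes E :: "('o1, 'a1) rcat" and B :: "('o2, 'a2) rcat"
    and p :: "('o1, 'a1, 'o2, 'a2) func"
    and T :: "('o3, 'a3) mcat" and S :: "('o4, 'a4) mcat"
    and q :: "('o3, 'a3, 'o4, 'a4) func"
  shows "(r_split_latent_fibration E B p \<longrightarrow> m_fibration (Total_mcat E) (Total_mcat B) p) \<and>
         (m_fibration T S q \<longrightarrow> r_split_latent_fibration (Par T) (Par S) (Par_map S q))"
  using r_split_latent_fibration.m_fibration_Total_mcat m_fibration.r_split_latent_fibration_Par by blast

end
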